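(* Let $C \subset \mathbb{P}^{2}_{\mathbb{C}}$ be an irreducible MK-curve of even degree $n\geq 8$. Assume that $C$ has $n_k$ singularities of type $A_k$ for $k=1,2$ and no other singularities. Then $$n_2-n_1 \geq 20-n.$$
   Context: ADE singularities of plane curves are those locally analytically equivalent to $A_k: x^2+y^{k+1}=0$ ($k\ge 1$), $D_k: x^2y+y^{k-1}=0$ ($k\geq 4$), $E_6: x^3+y^4=0$, $E_7: x^3+xy^3=0$, $E_8: x^3+y^5=0$. Let $C$ be a reduced plane curve of even degree with only ADE singularities, and let $X$ be the double cover of $\mathbb{P}^2_{\mathbb{C}}$ branched along $C$. Over each $p\in \mathrm{Sing}(C)$, $X$ has a rational double point of the same type. The Miyaoka-Kobayashi number of $p$ is $m(p)=3\left(e(E_p)-\frac{1}{\mathrm{ord}(G_p)}\right)-K(E_p)^2$, where $E_p$ is the exceptional curve over $p$ in the minimal resolution of $X$, $e$ is the topological Euler characteristic, $G_p$ is the associated small group, and $K(E_p)$ is the local canonical divisor (which is zero for rational double points). Explicitly, $m(A_k)=3(k+1)-\frac{3}{k+1}$ for $k\ge 1$, $m(D_k)=3(k+1)-\frac{3}{4(k-2)}$ for $k\ge 4$, $m(E_6)=\frac{167}{8}$, $m(E_7)=\frac{383}{16}$, $m(E_8)=\frac{1079}{40}$. Put $m(C)=\sum_{p\in \mathrm{Sing}(C)}m(p)$. MK-curve: a reduced curve $C\subset\mathbb{P}^2_{\mathbb{C}}$ of even degree $n\geq 6$ with only ADE singularities such that $m(C)=\frac{n}{2}(5n-6)$. 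*)

theory Defs
  imports
    "HOL-Analysis.Analysis"
    "HOL-Computational_Algebra.Polynomial_Factorial"
    "HOL-Computational_Algebra.Squarefree"
begin

(* A polynomial F in C[x,y,z] has type complex poly poly poly, with x the outermost and z the
   innermost variable: coeff (coeff (coeff F i) j) k is the coefficient of x^i y^j z^k. *)

type_synonym poly3 = "complex poly poly poly"

definition eval3 :: "poly3 \<Rightarrow> complex^3 \<Rightarrow> complex" where
  "eval3 F v = poly (poly (poly F [:[:v $ 1:]:]) [:v $ 2:]) (v $ 3)"

definition partial_x :: "poly3 \<Rightarrow> poly3" where
  "partial_x F = pderiv F"

definition partial_y :: "poly3 \<Rightarrow> poly3" where
  "partial_y F = map_poly pderiv F"

definition partial_z :: "poly3 \<Rightarrow> poly3" where
  "partial_z F = map_poly (map_poly pderiv) F"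

definition homogeneous :: "nat \<Rightarrow> poly3 \<Rightarrow> bool" where
  "homogeneous n F \<longleftrightarrow> (\<forall>i j k. coeff (coeff (coeff F i) j) k \<noteq> 0 \<longrightarrow> i + j + k = n)"

(* A reduced plane projective curve is given by a square-free form, unique up to a nonzero
   constant; the curve is irreducible iff the form is. *)

definition reduced_plane_curve :: "nat \<Rightarrow> poly3 \<Rightarrow> bool" where
  "reduced_plane_curve n F \<longleftrightarrow> F \<noteq> 0 \<and> homogeneous n F \<and> squarefree F"

(* Points of the complex projective plane are the lines through 0 in C^3. *)

definition proj_pt :: "complex^3 \<Rightarrow> (complex^3) set" where
  "proj_pt v = vec.span {v}"

definition Sing :: "poly3 \<Rightarrow> (complex^3) set set" where
  "Sing F = {proj_pt v | v. v \<noteq> 0 \<and> eval3 F v = 0 \<and>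
     eval3 (partial_x F) v = 0 \<and> eval3 (partial_y F) v = 0 \<and> eval3 (partial_z F) v = 0}"

definition affine_chart :: "3 \<Rightarrow> complex^2 \<Rightarrow> complex^3" where
  "affine_chart i a =
     (if i = 1 then vector [1, a $ 1, a $ 2]
      else if i = 2 then vector [a $ 1, 1, a $ 2]
      else vector [a $ 1, a $ 2, 1])"

(* Holomorphy in several variables: complex-linear Frechet derivative at every point. *)

definition holomorphic_fun :: "(complex^'n) set \<Rightarrow> (complex^'n \<Rightarrow> complex) \<Rightarrow> bool" where
  "holomorphic_fun U f \<longleftrightarrow> open U \<and>
     (\<forall>x\<in>U. \<exists>f'. (f has_derivative f') (at x) \<and> (\<forall>c v. f' (c *s v) = c * f' v))"

definition holomorphic_map :: "(complex^'n) set \<Rightarrow> (complex^'n \<Rightarrow> complex^'m) \<Rightarrow> bool" where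
  "holomorphic_map U f \<longleftrightarrow> (\<forall>i. holomorphic_fun U (\<lambda>x. f x $ i))"

(* The germ of {f = 0} at a is analytically equivalent to the germ of {g = 0} at b: some local
   biholomorphism from a to b pulls the ideal (g) back to the ideal (f). For reduced germs this
   amounts to mapping one zero set onto the other. *)

definition analytically_equivalent ::
  "(complex^2 \<Rightarrow> complex) \<Rightarrow> complex^2 \<Rightarrow> (complex^2 \<Rightarrow> complex) \<Rightarrow> complex^2 \<Rightarrow> bool" where
  "analytically_equivalent f a g b \<longleftrightarrow>
     (\<exists>U V \<phi> \<psi> u. a \<in> U \<and> b \<in> V \<and> \<phi> a = b \<and>
        homeomorphism U V \<phi> \<psi> \<and> holomorphic_map U \<phi> \<and> holomorphic_map V \<psi> \<and>
        holomorphic_fun U u \<and> (\<forall>x\<in>U. u x \<noteq> 0 \<and> g (\<phi> x) = u x * f x))"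

datatype ade = A nat | D nat | E6 | E7 | E8

fun valid_ade :: "ade \<Rightarrow> bool" where
  "valid_ade (A k) \<longleftrightarrow> k \<ge> 1"
| "valid_ade (D k) \<longleftrightarrow> k \<ge> 4"
| "valid_ade E6 \<longleftrightarrow> True"
| "valid_ade E7 \<longleftrightarrow> True"
| "valid_ade E8 \<longleftrightarrow> True"

fun ade_equation :: "ade \<Rightarrow> complex^2 \<Rightarrow> complex" where
  "ade_equation (A k) v = (v $ 1)^2 + (v $ 2)^(k + 1)"
| "ade_equation (D k) v = (v $ 1)^2 * v $ 2 + (v $ 2)^(k - 1)"
| "ade_equation E6 v = (v $ 1)^3 + (v $ 2)^4"
| "ade_equation E7 v = (v $ 1)^3 + v $ 1 * (v $ 2)^3"
| "ade_equation E8 v = (v $ 1)^3 + (v $ 2)^5"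

definition has_ade_type :: "poly3 \<Rightarrow> (complex^3) set \<Rightarrow> ade \<Rightarrow> bool" where
  "has_ade_type F p T \<longleftrightarrow> valid_ade T \<and>
     (\<exists>i a. p = proj_pt (affine_chart i a) \<and>
        analytically_equivalent (\<lambda>x. eval3 F (affine_chart i x)) a (ade_equation T) 0)"

(* The values 3 (e(E) - 1 / ord(G)) - K(E)^2 with e(E) = rank + 1, K(E) = 0 and
   ord(G) = k + 1, 4 (k - 2), 24, 48, 120 for A k, D k, E6, E7, E8. *)

fun MK_number :: "ade \<Rightarrow> real" where
  "MK_number (A k) = 3 * (real k + 1) - 3 / (real k + 1)"
| "MK_number (D k) = 3 * (real k + 1) - 3 / (4 * (real k - 2))"
| "MK_number E6 = 167 / 8"
| "MK_number E7 = 383 / 16"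
| "MK_number E8 = 1079 / 40"

(* A singular point has at most one ADE type, so the description below is proper. *)

definition MK_number_at :: "poly3 \<Rightarrow> (complex^3) set \<Rightarrow> real" where
  "MK_number_at F p = MK_number (THE T. has_ade_type F p T)"

definition MK_number_curve :: "poly3 \<Rightarrow> real" where
  "MK_number_curve F = (\<Sum>p\<in>Sing F. MK_number_at F p)"

definition MK_curve :: "nat \<Rightarrow> poly3 \<Rightarrow> bool" where
  "MK_curve n F \<longleftrightarrow> reduced_plane_curve n F \<and> even n \<and> n \<ge> 6 \<and>
     (\<forall>p\<in>Sing F. \<exists>T. has_ade_type F p T) \<and>
     MK_number_curve F = real n / 2 * (5 * real n - 6)"

end

theory Submission
  imports Defs "HOL-Complex_Analysis.Cauchy_Integral_Formula" "HOL-Computational_Algebra.Field_as_Ring"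
begin

text \<open>Since m(A1) = 9/2 and m(A2) = 8, being an MK-curve means 9 n1 + 16 n2 = n (5 n - 6), and this
  turns the Pluecker class d = n (n - 1) - 2 n1 - 3 n2 into n2 - n1 = 5 d - n. So d \<ge> 4 suffices.
  If n1 = 0, the claim is immediate from 16 n2 = n (5 n - 6). Otherwise let P be a node. The polar
  curve of P has degree n - 1 and meets the irreducible curve with multiplicity at least 2 at each
  node, at least 3 at each cusp, and at least 6 = 2 + 4 at P itself, so Bezout gives d \<ge> 4.

  The multiplicities enter Bezout's theorem only as lower bounds for the codimension of the local
  ideals modulo a power of the maximal ideal. These add up to at most the codimension of the ideal
  generated by the two forms in a large degree, because jets at distinct points can be prescribed
  independently.\<close>

section \<open>Ternary forms\<close>

text \<open>The \<open>4\<close> in \<open>6 = 2 + 4\<close> has a geometric source: among the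
  \<open>d\<close> tangents of the curve through a node, each of the two branch tangents counts at
  least twice. Algebraically, expanding the polar of \<open>P\<close> at \<open>P\<close> itself
  multiplies the part of degree \<open>k\<close> of the local equation by \<open>n - k\<close>, so
  equation and polar have proportional quadratic parts, and a combination of the two has order 3:
  the multiplicity is at least 2 * 3.

  A further obstacle is \<open>THE\<close> in \<open>MK_number_at\<close>: m(p) can be evaluated
  only once it is known that a point of type A1 or A2 has no other ADE type. The invariants needed
  are extracted from limits along complex lines: the quadratic part, through the derivative of the
  coordinate change, and for A2 the contact with smooth arcs. The same quadratic parts supply the
  jets that bound the local codimensions. Irreducibility enters as primality of the form in a
  factorial ring, which controls the syzygies in the dimension count.\<close>

abbreviation coeff3 :: "poly3 \<Rightarrow> nat \<Rightarrow> nat \<Rightarrow> nat \<Rightarrow> complex" where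
  "coeff3 F i j k \<equiv> coeff (coeff (coeff F i) j) k"

abbreviation scale3 :: "complex \<Rightarrow> poly3 \<Rightarrow> poly3" where
  "scale3 c F \<equiv> smult [:[:c:]:] F"

lemma poly3_eqI: "(\<And>i j k. coeff3 F i j k = coeff3 G i j k) \<Longrightarrow> F = G"
  by (intro poly_eqI) blast

lemma coeff3_mult:
  "coeff3 (F * G) i j k =
     (\<Sum>a\<le>i. \<Sum>b\<le>j. \<Sum>c\<le>k. coeff3 F a b c * coeff3 G (i - a) (j - b) (k - c))"
  by (simp add: coeff_mult coeff_sum)

lemma coeff3_scale: "coeff3 (scale3 c F) i j k = c * coeff3 F i j k"
  by simp

interpretation poly3: vector_space scale3
  by unfold_locales (auto intro!: poly3_eqI simp: algebra_simps)

lemma homogeneous_0: "homogeneous d 0"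
  by (simp add: homogeneous_def)

lemma homogeneous_add: "homogeneous d F \<Longrightarrow> homogeneous d G \<Longrightarrow> homogeneous d (F + G)"
  unfolding homogeneous_def by (metis add.right_neutral coeff_add)

lemma homogeneous_scale: "homogeneous d F \<Longrightarrow> homogeneous d (scale3 c F)"
  unfolding homogeneous_def by (metis coeff3_scale mult_zero_right)

lemma homogeneous_sum: "(\<And>x. x \<in> X \<Longrightarrow> homogeneous d (f x)) \<Longrightarrow> homogeneous d (\<Sum>x\<in>X. f x)"
  by (induction X rule: infinite_finite_induct) (auto simp: homogeneous_0 homogeneous_add)

lemma homogeneous_mult:
  assumes "homogeneous d F" "homogeneous e G"
  shows "homogeneous (d + e) (F * G)"
  unfolding homogeneous_def
proof (intro allI impI)
  fix i j k
  assume "coeff3 (F * G) i j k \<noteq> 0"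
  then obtain a b c where *: "a \<le> i" "b \<le> j" "c \<le> k"
    "coeff3 F a b c * coeff3 G (i - a) (j - b) (k - c) \<noteq> 0"
    unfolding coeff3_mult by (metis (no_types, lifting) atMost_iff sum.neutral)
  then have nz: "coeff3 F a b c \<noteq> 0" "coeff3 G (i - a) (j - b) (k - c) \<noteq> 0" by auto
  have "a + b + c = d" "(i - a) + (j - b) + (k - c) = e"
    using assms nz unfolding homogeneous_def by blast+
  with * show "i + j + k = d + e" by linarith
qed

lemma homogeneous_1: "homogeneous 0 1"
  by (simp add: homogeneous_def one_pCons coeff_pCons split: nat.splits)

lemma homogeneous_power: "homogeneous d F \<Longrightarrow> homogeneous (d * m) (F ^ m)"
  by (induction m) (auto simp: homogeneous_1 intro: homogeneous_mult)

lemma homogeneous_prod: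
  "(\<And>x. x \<in> X \<Longrightarrow> homogeneous d (f x)) \<Longrightarrow> homogeneous (d * card X) (\<Prod>x\<in>X. f x)"
  by (induction X rule: infinite_finite_induct) (auto simp: homogeneous_1 intro: homogeneous_mult)

section \<open>Monomials of a fixed degree and their number\<close>

definition mon3 :: "nat \<times> nat \<times> nat \<Rightarrow> poly3" where
  "mon3 = (\<lambda>(i, j, k). monom (monom (monom 1 k) j) i)"

lemma coeff3_mon3: "coeff3 (mon3 t) i j k = (if t = (i, j, k) then 1 else 0)"
  by (auto simp: mon3_def split: prod.splits)

definition exps :: "nat \<Rightarrow> (nat \<times> nat \<times> nat) set" where
  "exps d = {(i, j, k). i + j + k = d}"

lemma exps_eq: "exps d = (\<lambda>(i, j). (i, j, d - i - j)) ` (SIGMA i:{..d}. {..d - i})"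
  by (force simp: exps_def)

lemma finite_exps [simp]: "finite (exps d)"
  by (simp add: exps_eq)

lemma card_exps: "2 * card (exps d) = (d + 1) * (d + 2)"
proof -
  have "card (exps d) = card (SIGMA i:{..d}. {..d - i})"
    unfolding exps_eq by (rule card_image) (auto simp: inj_on_def)
  also have "\<dots> = (\<Sum>i\<le>d. Suc (d - i))"
    by simp
  also have "\<dots> = (\<Sum>i\<le>d. Suc i)"
    by (rule sum.reindex_bij_witness[of _ "\<lambda>i. d - i" "\<lambda>i. d - i"]) auto
  also have "2 * \<dots> = (d + 1) * (d + 2)"
    by (induction d) auto
  finally show ?thesis .
qed

lemma homogeneous_mon3: "t \<in> exps d \<Longrightarrow> homogeneous d (mon3 t)"
  by (auto simp: homogeneous_def coeff3_mon3 exps_def)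

lemma coeff3_sum_mon3:
  assumes "finite X"
  shows "coeff3 (\<Sum>t\<in>X. scale3 (c t) (mon3 t)) i j k = (if (i, j, k) \<in> X then c (i, j, k) else 0)"
proof -
  have "coeff3 (\<Sum>t\<in>X. scale3 (c t) (mon3 t)) i j k = (\<Sum>t\<in>X. if t = (i, j, k) then c t else 0)"
    by (simp add: coeff_sum coeff3_mon3 if_distrib cong: if_cong)
  then show ?thesis using assms by simp
qed

lemma homogeneous_expansion:
  assumes "homogeneous d F"
  shows "F = (\<Sum>(i, j, k)\<in>exps d. scale3 (coeff3 F i j k) (mon3 (i, j, k)))"
proof -
  have "F = (\<Sum>t\<in>exps d. scale3 ((\<lambda>(i, j, k). coeff3 F i j k) t) (mon3 t))"
    by (rule poly3_eqI, subst coeff3_sum_mon3[OF finite_exps])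
      (use assms in \<open>auto simp: homogeneous_def exps_def\<close>)
  then show ?thesis by (simp add: case_prod_unfold)
qed

lemma homogeneous_in_span: "homogeneous d F \<Longrightarrow> F \<in> poly3.span (mon3 ` exps d)"
  by (subst homogeneous_expansion)
    (auto intro!: poly3.span_sum poly3.span_scale intro: poly3.span_base)

lemma card_mon3_le: "card (mon3 ` exps d) \<le> card (exps d)"
  by (simp add: card_image_le)

subsection \<open>Leading monomials\<close>

text \<open>The lexicographically largest exponent of a nonzero polynomial, for the order x > y >
  z.\<close>

definition lead_exp :: "poly3 \<Rightarrow> nat \<times> nat \<times> nat" where
  "lead_exp F = (degree F, degree (lead_coeff F), degree (lead_coeff (lead_coeff F)))"

lemma lead_exp_mult:
  assumes "F \<noteq> 0" "G \<noteq> 0" "lead_exp F = (a, b, c)" "lead_exp G = (a', b', c')"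
  shows "lead_exp (F * G) = (a + a', b + b', c + c')"
  using assms by (auto simp: lead_exp_def degree_mult_eq coeff_mult_degree_sum)

lemma lead_exp_nonzero:
  assumes "F \<noteq> 0" "lead_exp F = (i, j, k)"
  shows "coeff3 F i j k \<noteq> 0"
  using assms by (auto simp: lead_exp_def)

text \<open>When \<open>(a, b, c)\<close> is the leading exponent of a form \<open>F\<close>, these
  are the standard monomials: in degree \<open>e\<close> they span a complement to the multiples of
  \<open>F\<close>.\<close>

definition exps_not_dvd :: "nat \<times> nat \<times> nat \<Rightarrow> nat \<Rightarrow> (nat \<times> nat \<times> nat) set" where
  "exps_not_dvd = (\<lambda>(a, b, c) e. {(i, j, k) \<in> exps e. \<not> (a \<le> i \<and> b \<le> j \<and> c \<le> k)})"

lemma exps_not_dvd_subset: "exps_not_dvd t e \<subseteq> exps e"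
  by (auto simp: exps_not_dvd_def split: prod.splits)

text \<open>Multiplication by the monomial \<open>t\<close> is a bijection from
  \<open>exps e\<close> onto the exponents divisible by \<open>t\<close>.\<close>

lemma card_exps_not_dvd:
  assumes "t \<in> exps n"
  shows "card (exps_not_dvd t (n + e)) + card (exps e) = card (exps (n + e))"
proof -
  obtain a b c where t: "t = (a, b, c)" by (cases t)
  have abc: "a + b + c = n" using assms by (simp add: t exps_def)
  let ?f = "\<lambda>(i, j, k). (a + i, b + j, c + k)"
  have "exps (n + e) = exps_not_dvd t (n + e) \<union> ?f ` exps e"
  proof (intro subset_antisym subsetI)
    fix x assume x: "x \<in> exps (n + e)"
    obtain i j k where ijk: "x = (i, j, k)" by (cases x)
    show "x \<in> exps_not_dvd t (n + e) \<union> ?f ` exps e"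
    proof (cases "a \<le> i \<and> b \<le> j \<and> c \<le> k")
      case True
      then have "x = ?f (i - a, j - b, k - c)" "(i - a, j - b, k - c) \<in> exps e"
        using x abc by (auto simp: exps_def ijk)
      then show ?thesis by blast
    qed (use x in \<open>auto simp: exps_not_dvd_def t ijk\<close>)
  qed (use abc in \<open>auto simp: exps_not_dvd_def t exps_def\<close>)
  moreover have "exps_not_dvd t (n + e) \<inter> ?f ` exps e = {}"
    by (auto simp: exps_not_dvd_def t)
  moreover have "card (?f ` exps e) = card (exps e)"
    by (rule card_image) (auto simp: inj_on_def)
  ultimately show ?thesis
    by (metis (no_types, lifting) card_Un_disjoint finite_Un finite_exps)
qed

lemma lead_exp_homogeneous: "homogeneous n F \<Longrightarrow> F \<noteq> 0 \<Longrightarrow> lead_exp F \<in> exps n"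
  using lead_exp_nonzero[of F] by (cases "lead_exp F") (auto simp: homogeneous_def exps_def)

text \<open>A nonzero multiple of \<open>F\<close> has a leading exponent divisible by that of
  \<open>F\<close>, whereas only standard monomials occur in the sum. So the sum is zero, and its
  coefficients are the \<open>c t\<close>.\<close>

lemma multiple_not_in_exps_not_dvd:
  assumes "F dvd (\<Sum>t\<in>exps_not_dvd (lead_exp F) e. scale3 (c t) (mon3 t))"
    and "t \<in> exps_not_dvd (lead_exp F) e"
  shows "c t = 0"
proof -
  let ?X = "exps_not_dvd (lead_exp F) e"
  have fin: "finite ?X" using exps_not_dvd_subset finite_exps by (rule finite_subset)
  define S where "S = (\<Sum>t\<in>?X. scale3 (c t) (mon3 t))"
  have "S = 0"
  proof (rule ccontr)
    assume S: "S \<noteq> 0"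
    from assms(1) obtain H where H: "S = F * H" unfolding S_def by (elim dvdE)
    with S have nz: "F \<noteq> 0" "H \<noteq> 0" by auto
    obtain i j k i' j' k' where l: "lead_exp F = (i, j, k)" "lead_exp H = (i', j', k')"
      by (metis prod_cases3)
    have "coeff3 S (i + i') (j + j') (k + k') \<noteq> 0"
      using lead_exp_nonzero[OF S] lead_exp_mult[OF nz l] H by auto
    then have "(i + i', j + j', k + k') \<in> ?X"
      unfolding S_def coeff3_sum_mon3[OF fin] by presburger
    then show False by (auto simp: exps_not_dvd_def l)
  qed
  obtain i j k where t: "t = (i, j, k)" by (cases t)
  have "coeff3 S i j k = c t"
    unfolding S_def coeff3_sum_mon3[OF fin] using assms(2) by (simp add: t)
  with \<open>S = 0\<close> show ?thesis by simp
qed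

text \<open>The cofactor is not known to be homogeneous, so degrees are compared through the leading
  monomials of \<open>F\<close> and \<open>G\<close>, which have degrees \<open>n\<close> and
  \<open>m\<close>.\<close>

lemma homogeneous_not_dvd:
  assumes "homogeneous n F" "homogeneous m G" "G \<noteq> 0" "m < n"
  shows "\<not> F dvd G"
proof
  assume "F dvd G"
  then obtain H where H: "G = F * H" by (elim dvdE)
  with assms have nz: "F \<noteq> 0" "H \<noteq> 0" by auto
  obtain a b c a' b' c' where l: "lead_exp F = (a, b, c)" "lead_exp H = (a', b', c')"
    by (metis prod_cases3)
  have "coeff3 F a b c \<noteq> 0" "coeff3 G (a + a') (b + b') (c + c') \<noteq> 0"
    using lead_exp_nonzero[OF nz(1) l(1)] lead_exp_nonzero[OF assms(3)] lead_exp_mult[OF nz l] H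
    by auto
  with assms(1,2) have "a + b + c = n" "a + a' + (b + b') + (c + c') = m"
    unfolding homogeneous_def by blast+
  with \<open>m < n\<close> show False by linarith
qed

section \<open>Local expansions\<close>

type_synonym poly2 = "complex poly poly"

abbreviation coeff2 :: "poly2 \<Rightarrow> nat \<Rightarrow> nat \<Rightarrow> complex" where
  "coeff2 f i j \<equiv> coeff (coeff f i) j"

abbreviation const2 :: "complex \<Rightarrow> poly2" where
  "const2 c \<equiv> [:[:c:]:]"

abbreviation Y2 :: poly2 where "Y2 \<equiv> [:0, 1:]"
abbreviation Z2 :: poly2 where "Z2 \<equiv> [:[:0, 1:]:]"

lemma poly2_eqI: "(\<And>i j. coeff2 f i j = coeff2 g i j) \<Longrightarrow> f = g"
  by (intro poly_eqI) blast

lemma coeff2_mult: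
  "coeff2 (f * g) i j = (\<Sum>a\<le>i. \<Sum>b\<le>j. coeff2 f a b * coeff2 g (i - a) (j - b))"
  by (simp add: coeff_mult coeff_sum)

section \<open>Substitution homomorphisms from ternary to binary polynomials\<close>

definition subst_hom :: "('a::comm_ring_1 \<Rightarrow> 'b::comm_ring_1) \<Rightarrow> 'b \<Rightarrow> 'a poly \<Rightarrow> 'b" where
  "subst_hom h r p = poly (map_poly h p) r"

definition ring_hom :: "('a::comm_ring_1 \<Rightarrow> 'b::comm_ring_1) \<Rightarrow> bool" where
  "ring_hom h \<longleftrightarrow> h 0 = 0 \<and> h 1 = 1 \<and> (\<forall>x y. h (x + y) = h x + h y) \<and> (\<forall>x y. h (x * y) = h x * h y)"

lemma subst_hom_0 [simp]: "subst_hom h r 0 = 0"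
  by (simp add: subst_hom_def)

lemma subst_hom_pCons: "h 0 = 0 \<Longrightarrow> subst_hom h r (pCons a p) = h a + r * subst_hom h r p"
  by (simp add: subst_hom_def map_poly_pCons)

lemma ring_hom_subst_hom:
  assumes "ring_hom h"
  shows "ring_hom (subst_hom h r)"
proof -
  have h: "h 0 = 0" "h 1 = 1" "\<And>x y. h (x + y) = h x + h y" "\<And>x y. h (x * y) = h x * h y"
    using assms by (auto simp: ring_hom_def)
  have add: "subst_hom h r (p + q) = subst_hom h r p + subst_hom h r q" for p q
    by (induction p q rule: poly_induct2) (auto simp: subst_hom_pCons h algebra_simps)
  have smult: "subst_hom h r (smult c p) = h c * subst_hom h r p" for c p
    by (induction p) (auto simp: subst_hom_pCons h algebra_simps)
  have "subst_hom h r (p * q) = subst_hom h r p * subst_hom h r q" for p q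
    by (induction p) (auto simp: subst_hom_pCons h algebra_simps add smult)
  with add show ?thesis
    by (auto simp: ring_hom_def h one_pCons subst_hom_pCons)
qed

definition hom3 :: "poly2 \<Rightarrow> poly2 \<Rightarrow> poly2 \<Rightarrow> poly3 \<Rightarrow> poly2" where
  "hom3 r1 r2 r3 = subst_hom (subst_hom (subst_hom const2 r3) r2) r1"

lemma ring_hom_const2: "ring_hom const2"
  by (simp add: ring_hom_def one_pCons)

lemma ring_hom_hom3: "ring_hom (hom3 r1 r2 r3)"
  unfolding hom3_def by (intro ring_hom_subst_hom ring_hom_const2)

context
  fixes r1 r2 r3 :: poly2
begin

lemma hom3_pCons:
  "subst_hom const2 r3 (pCons a p) = const2 a + r3 * subst_hom const2 r3 p"
  "subst_hom (subst_hom const2 r3) r2 (pCons p q) =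
     subst_hom const2 r3 p + r2 * subst_hom (subst_hom const2 r3) r2 q"
  "hom3 r1 r2 r3 (pCons q F) = subst_hom (subst_hom const2 r3) r2 q + r1 * hom3 r1 r2 r3 F"
  unfolding hom3_def by (subst subst_hom_pCons; simp)+

lemma hom3_0 [simp]: "hom3 r1 r2 r3 0 = 0"
  and hom3_1 [simp]: "hom3 r1 r2 r3 1 = 1"
  and hom3_add: "hom3 r1 r2 r3 (F + G) = hom3 r1 r2 r3 F + hom3 r1 r2 r3 G"
  and hom3_mult: "hom3 r1 r2 r3 (F * G) = hom3 r1 r2 r3 F * hom3 r1 r2 r3 G"
  using ring_hom_hom3[of r1 r2 r3] by (auto simp: ring_hom_def)

lemma hom3_scale: "hom3 r1 r2 r3 (scale3 c F) = const2 c * hom3 r1 r2 r3 F"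
proof -
  have "scale3 c F = [:[:[:c:]:]:] * F" by simp
  then have "hom3 r1 r2 r3 (scale3 c F) = hom3 r1 r2 r3 [:[:[:c:]:]:] * hom3 r1 r2 r3 F"
    by (simp only: hom3_mult)
  also have "hom3 r1 r2 r3 [:[:[:c:]:]:] = const2 c"
    by (simp add: hom3_pCons)
  finally show ?thesis .
qed

lemma hom3_sum: "hom3 r1 r2 r3 (\<Sum>x\<in>X. f x) = (\<Sum>x\<in>X. hom3 r1 r2 r3 (f x))"
  by (induction X rule: infinite_finite_induct) (auto simp: hom3_add)

lemma hom3_prod: "hom3 r1 r2 r3 (\<Prod>x\<in>X. f x) = (\<Prod>x\<in>X. hom3 r1 r2 r3 (f x))"
  by (induction X rule: infinite_finite_induct) (auto simp: hom3_mult)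

lemma hom3_power: "hom3 r1 r2 r3 (F ^ m) = hom3 r1 r2 r3 F ^ m"
  by (induction m) (auto simp: hom3_mult)

lemma poly_hom3:
  "poly (poly (hom3 r1 r2 r3 F) [:s:]) t =
   eval3 F (vector [poly (poly r1 [:s:]) t, poly (poly r2 [:s:]) t, poly (poly r3 [:s:]) t])"
proof -
  let ?e = "\<lambda>r. poly (poly r [:s:]) t"
  have 1: "?e (subst_hom const2 r3 p) = poly p (?e r3)" for p
    by (induction p) (auto simp: hom3_pCons)
  have 2: "?e (subst_hom (subst_hom const2 r3) r2 q) = poly (poly q [:?e r2:]) (?e r3)" for q
    by (induction q) (auto simp: hom3_pCons 1)
  have "?e (hom3 r1 r2 r3 F) = poly (poly (poly F [:[:?e r1:]:]) [:?e r2:]) (?e r3)"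
    by (induction F) (auto simp: hom3_pCons 2)
  then show ?thesis by (simp add: eval3_def)
qed

text \<open>The chain rule, stated for an abstract derivation so that one induction serves both
  partial derivatives of \<open>poly2\<close>.\<close>

lemma derivation_hom3:
  assumes add: "\<And>f g. \<delta> (f + g) = \<delta> f + \<delta> g"
    and mult: "\<And>f g. \<delta> (f * g) = f * \<delta> g + g * \<delta> f" 
    and const: "\<And>c. \<delta> (const2 c) = 0"
  shows "\<delta> (hom3 r1 r2 r3 F) = \<delta> r1 * hom3 r1 r2 r3 (partial_x F)
    + \<delta> r2 * hom3 r1 r2 r3 (partial_y F) + \<delta> r3 * hom3 r1 r2 r3 (partial_z F)"
proof -
  let ?h1 = "subst_hom const2 r3" and ?h2 = "subst_hom (subst_hom const2 r3) r2"
  have 0: "\<delta> 0 = 0" using const[of 0] by simp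
  have a1: "?h1 (p + q) = ?h1 p + ?h1 q" for p q
    using ring_hom_subst_hom[OF ring_hom_const2] by (auto simp: ring_hom_def)
  have a2: "?h2 (p + q) = ?h2 p + ?h2 q" for p q
    using ring_hom_subst_hom[OF ring_hom_subst_hom[OF ring_hom_const2]] by (auto simp: ring_hom_def)
  have 1: "\<delta> (?h1 p) = \<delta> r3 * ?h1 (pderiv p)" for p
    by (induction p)
      (auto simp: hom3_pCons 0 add mult const a1 pderiv_pCons algebra_simps simp del: mult_pCons_left)
  have 2: "\<delta> (?h2 p) = \<delta> r2 * ?h2 (pderiv p) + \<delta> r3 * ?h2 (map_poly pderiv p)" for p
    by (induction p)
      (auto simp: hom3_pCons 0 add mult const 1 a2 pderiv_pCons map_poly_pCons algebra_simps
        simp del: mult_pCons_left)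
  show ?thesis
    by (induction F)
      (auto simp: hom3_pCons 0 add mult const 2 hom3_add pderiv_pCons map_poly_pCons algebra_simps
        partial_x_def partial_y_def partial_z_def simp del: mult_pCons_left)
qed

end

text \<open>The expansion at \<^term>\<open>affine_chart i a\<close>: the coordinates of the chart become
  \<open>a $ 1 + Y2\<close> and \<open>a $ 2 + Z2\<close>.\<close>

definition loc :: "3 \<Rightarrow> complex^2 \<Rightarrow> poly3 \<Rightarrow> poly2" where
  "loc i a = (let u = const2 (a $ 1) + Y2; v = const2 (a $ 2) + Z2
     in if i = 1 then hom3 1 u v else if i = 2 then hom3 u 1 v else hom3 u v 1)"

lemma loc_cases:
  obtains "i = 1" "loc i a = hom3 1 (const2 (a $ 1) + Y2) (const2 (a $ 2) + Z2)"
  | "i = 2" "loc i a = hom3 (const2 (a $ 1) + Y2) 1 (const2 (a $ 2) + Z2)"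
  | "i = 3" "loc i a = hom3 (const2 (a $ 1) + Y2) (const2 (a $ 2) + Z2) 1"
  using exhaust_3[of i] by (auto simp: loc_def Let_def)

lemma loc_0 [simp]: "loc i a 0 = 0"
  and loc_1 [simp]: "loc i a 1 = 1"
  and loc_add: "loc i a (F + G) = loc i a F + loc i a G"
  and loc_mult: "loc i a (F * G) = loc i a F * loc i a G"
  and loc_scale: "loc i a (scale3 c F) = const2 c * loc i a F"
  and loc_sum: "loc i a (\<Sum>x\<in>X. f x) = (\<Sum>x\<in>X. loc i a (f x))"
  and loc_prod: "loc i a (\<Prod>x\<in>X. f x) = (\<Prod>x\<in>X. loc i a (f x))"
  and loc_power: "loc i a (F ^ m) = loc i a F ^ m"
  by (cases i a rule: loc_cases;
      simp add: hom3_add hom3_mult hom3_scale hom3_sum hom3_prod hom3_power)+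

lemma poly_loc:
  "poly (poly (loc i a F) [:s:]) t = eval3 F (affine_chart i (a + vector [s, t]))"
  by (cases i a rule: loc_cases) (auto simp: poly_hom3 affine_chart_def)

lemma coeff2_loc_0: "coeff2 (loc i a F) 0 0 = eval3 F (affine_chart i a)"
proof -
  have "vector [0, 0] = (0 :: complex^2)" by (simp add: vec_eq_iff forall_2)
  then show ?thesis
    using poly_loc[of i a F 0 0] by (simp add: poly_0_coeff_0)
qed

subsection \<open>Linear forms\<close>

abbreviation X3 :: poly3 where "X3 \<equiv> [:0, 1:]"
abbreviation Y3 :: poly3 where "Y3 \<equiv> [:[:0, 1:]:]"
abbreviation Z3 :: poly3 where "Z3 \<equiv> [:[:[:0, 1:]:]:]"

definition linear_form :: "complex^3 \<Rightarrow> poly3" where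
  "linear_form u = scale3 (u $ 1) X3 + scale3 (u $ 2) Y3 + scale3 (u $ 3) Z3"

lemma homogeneous_linear_form: "homogeneous 1 (linear_form u)"
  by (auto simp: homogeneous_def linear_form_def coeff_pCons split: nat.splits)

lemma eval3_linear_form: "eval3 (linear_form u) v = u $ 1 * v $ 1 + u $ 2 * v $ 2 + u $ 3 * v $ 3"
  by (simp add: eval3_def linear_form_def algebra_simps)

lemma hom3_linear_form:
  "hom3 r1 r2 r3 (linear_form u) = const2 (u $ 1) * r1 + const2 (u $ 2) * r2 + const2 (u $ 3) * r3"
  by (simp add: linear_form_def hom3_add hom3_scale hom3_pCons)

text \<open>These forms lift the local coordinates. Powers of \<open>U\<close> raise the degree
  without changing the expansion, so every binary polynomial is the expansion of a form of any
  sufficiently large degree.\<close>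

lemma local_coordinates:
  obtains S T U where "homogeneous 1 S" "homogeneous 1 T" "homogeneous 1 U"
    "loc i a S = Y2" "loc i a T = Z2" "loc i a U = 1"
proof (cases i a rule: loc_cases)
  case 1
  show thesis
    by (rule that[of "linear_form (vector [- a $ 1, 1, 0])" "linear_form (vector [- a $ 2, 0, 1])"
          "linear_form (vector [1, 0, 0])"])
      (auto simp: homogeneous_linear_form 1(2) hom3_linear_form one_pCons simp del: One_nat_def)
next
  case 2
  show thesis
    by (rule that[of "linear_form (vector [1, - a $ 1, 0])" "linear_form (vector [0, - a $ 2, 1])"
          "linear_form (vector [0, 1, 0])"])
      (auto simp: homogeneous_linear_form 2(2) hom3_linear_form one_pCons simp del: One_nat_def)
next
  case 3
  show thesis
    by (rule that[of "linear_form (vector [1, 0, - a $ 1])" "linear_form (vector [0, 1, - a $ 2])"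
          "linear_form (vector [0, 0, 1])"])
      (auto simp: homogeneous_linear_form 3(2) hom3_linear_form one_pCons simp del: One_nat_def)
qed

lemma proj_pt_scale: "c \<noteq> 0 \<Longrightarrow> proj_pt (c *s v) = proj_pt v"
  unfolding proj_pt_def vec.span_singleton
proof safe
  fix k assume "c \<noteq> 0"
  then have "k *s v = (k / c) *s (c *s v)" by simp
  then show "k *s v \<in> range (\<lambda>k. k *s (c *s v))" by blast
qed auto

lemma affine_chart_nth: "affine_chart i a $ i = 1"
  using exhaust_3[of i] by (auto simp: affine_chart_def)

lemma affine_chart_nonzero: "affine_chart i a \<noteq> 0"
  using affine_chart_nth[of i a] by (metis zero_index zero_neq_one)

lemma separating_linear_form:
  assumes "proj_pt (affine_chart i a) \<noteq> proj_pt (affine_chart j b)"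
  obtains L where "homogeneous 1 L" "coeff2 (loc i a L) 0 0 \<noteq> 0" "coeff2 (loc j b L) 0 0 = 0"
proof -
  let ?v = "affine_chart i a" and ?w = "affine_chart j b"
  have "\<exists>u. eval3 (linear_form u) ?w = 0 \<and> eval3 (linear_form u) ?v \<noteq> 0"
  proof (rule ccontr)
    assume "\<not> ?thesis"
    then have *: "u $ 1 * ?w $ 1 + u $ 2 * ?w $ 2 + u $ 3 * ?w $ 3 = 0 \<Longrightarrow>
        u $ 1 * ?v $ 1 + u $ 2 * ?v $ 2 + u $ 3 * ?v $ 3 = 0" for u :: "complex^3"
      unfolding eval3_linear_form by blast
    \<comment> \<open>The test vectors produce the three 2 by 2 minors of the coordinate vectors
      \<open>?v\<close> and \<open>?w\<close>.\<close>
    have "?w $ 2 * ?v $ 1 = ?w $ 1 * ?v $ 2"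
      using *[of "vector [?w $ 2, - ?w $ 1, 0]"] by (simp add: mult.commute)
    moreover have "?w $ 3 * ?v $ 1 = ?w $ 1 * ?v $ 3"
      using *[of "vector [?w $ 3, 0, - ?w $ 1]"] by (simp add: mult.commute)
    moreover have "?w $ 3 * ?v $ 2 = ?w $ 2 * ?v $ 3"
      using *[of "vector [0, ?w $ 3, - ?w $ 2]"] by (simp add: mult.commute)
    ultimately have "?v $ k * ?w $ j = ?v $ j * ?w $ k" for k
      using exhaust_3[of k] exhaust_3[of j] by (auto simp: mult.commute)
    \<comment> \<open>The factor is \<open>?v $ j\<close>, because the chart makes
      \<open>?w $ j\<close> equal to 1.\<close>
    then obtain c where v: "?v = c *s ?w"
      by (metis (no_types, lifting) affine_chart_nth mult.right_neutral vec_eq_iff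
          vector_smult_component)
    have "c \<noteq> 0"
      using affine_chart_nonzero[of i a] by (auto simp: v)
    then have "proj_pt (c *s ?w) = proj_pt ?w" by (rule proj_pt_scale)
    with v assms show False by metis
  qed
  then show thesis
    using that homogeneous_linear_form coeff2_loc_0 by metis
qed

subsection \<open>Order of vanishing\<close>

text \<open>Membership in the \<open>k\<close>-th power of the maximal ideal of the origin.\<close>

definition vanishes :: "nat \<Rightarrow> poly2 \<Rightarrow> bool" where
  "vanishes k f \<longleftrightarrow> (\<forall>i j. i + j < k \<longrightarrow> coeff2 f i j = 0)"

lemma vanishes_0 [simp]: "vanishes k 0"
  and vanishes_zero_order [simp]: "vanishes 0 f"
  and vanishes_uminus: "vanishes k f \<Longrightarrow> vanishes k (- f)"
  and vanishes_add: "vanishes k f \<Longrightarrow> vanishes k g \<Longrightarrow> vanishes k (f + g)"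
  and vanishes_diff: "vanishes k f \<Longrightarrow> vanishes k g \<Longrightarrow> vanishes k (f - g)"
  and vanishes_mono: "vanishes l f \<Longrightarrow> k \<le> l \<Longrightarrow> vanishes k f"
  by (auto simp: vanishes_def)

lemma vanishes_mult:
  assumes "vanishes k f" "vanishes l g"
  shows "vanishes (k + l) (f * g)"
  unfolding vanishes_def coeff2_mult
proof (intro allI impI sum.neutral ballI)
  fix i j x y assume *: "i + j < k + l" "x \<in> {..i}" "y \<in> {..j}"
  then have "x + y < k \<or> (i - x) + (j - y) < l" by auto
  then show "coeff2 f x y * coeff2 g (i - x) (j - y) = 0"
    using assms by (auto simp: vanishes_def)
qed

lemma vanishes_mult_left: "vanishes k f \<Longrightarrow> vanishes k (g * f)"
  and vanishes_mult_right: "vanishes k f \<Longrightarrow> vanishes k (f * g)"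
  using vanishes_mult[of k f 0 g] vanishes_mult[of 0 g k f] by auto

lemma vanishes_power: "vanishes 1 f \<Longrightarrow> vanishes m (f ^ m)"
  using vanishes_mult[of 1 f] by (induction m) auto

lemma vanishes_sum: "(\<And>x. x \<in> X \<Longrightarrow> vanishes k (f x)) \<Longrightarrow> vanishes k (\<Sum>x\<in>X. f x)"
  by (induction X rule: infinite_finite_induct) (auto intro: vanishes_add)

lemma vanishes_1: "vanishes 1 f \<longleftrightarrow> coeff2 f 0 0 = 0"
  by (auto simp: vanishes_def)

lemma vanishes_trans: "vanishes k (f - g) \<Longrightarrow> vanishes k (g - h) \<Longrightarrow> vanishes k (f - h)"
  using vanishes_add[of k "f - g" "g - h"] by simp

text \<open>After scaling, \<open>f\<close> is \<open>1 - e\<close> with \<open>e\<close> in the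
  maximal ideal, and the finite geometric series inverts \<open>1 - e\<close> up to order
  \<open>k\<close>.\<close>

lemma truncated_division:
  assumes "coeff2 f 0 0 \<noteq> 0"
  obtains g where "vanishes k (f * g - h)"
proof -
  define c where "c = coeff2 f 0 0"
  define e where "e = 1 - const2 (1 / c) * f"
  have "vanishes 1 e"
    using assms by (simp add: vanishes_1 e_def c_def one_pCons del: One_nat_def)
  then have "vanishes k (- (h * e ^ k))"
    by (intro vanishes_uminus vanishes_mult_left vanishes_power)
  moreover have "f * (const2 (1 / c) * (\<Sum>i<k. e ^ i) * h) - h = - (h * e ^ k)"
  proof -
    have "(1 - e) * (\<Sum>i<k. e ^ i) = 1 - e ^ k" by (simp add: one_diff_power_eq)
    moreover have "f * const2 (1 / c) = 1 - e" by (simp add: e_def)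
    ultimately have "f * const2 (1 / c) * (\<Sum>i<k. e ^ i) = 1 - e ^ k" by metis
    then have "f * const2 (1 / c) * (\<Sum>i<k. e ^ i) * h = (1 - e ^ k) * h" by metis
    then show ?thesis by (simp add: algebra_simps)
  qed
  ultimately show thesis using that by metis
qed

definition jets :: "nat \<Rightarrow> (nat \<times> nat) set" where
  "jets k = {(i, j). i + j < k}"

lemma finite_jets [simp]: "finite (jets k)"
  by (rule finite_subset[of _ "{..<k} \<times> {..<k}"]) (auto simp: jets_def)

lemma coeff2_monomial: "coeff2 (Y2 ^ a * Z2 ^ b) i j = (if i = a \<and> j = b then 1 else 0)"
proof -
  have "Y2 ^ a = monom 1 a" by (simp add: monom_altdef)
  moreover have "Z2 ^ b = [:monom 1 b:]"
    by (induction b) (auto simp: one_pCons monom_0 monom_Suc)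
  ultimately show ?thesis by (auto simp: coeff_monom_mult coeff_pCons split: nat.splits)
qed

lemma coeff2_jet_sum:
  "coeff2 (\<Sum>(a, b)\<in>jets k. const2 (c a b) * (Y2 ^ a * Z2 ^ b)) i j =
    (if i + j < k then c i j else 0)"
proof -
  have "coeff2 (const2 (c a b) * (Y2 ^ a * Z2 ^ b)) i j = (if (a, b) = (i, j) then c a b else 0)" for a b
    using coeff2_monomial[of a b i j] by auto
  then have "coeff2 (\<Sum>(a, b)\<in>jets k. const2 (c a b) * (Y2 ^ a * Z2 ^ b)) i j =
     (\<Sum>x\<in>jets k. if x = (i, j) then c i j else 0)"
    unfolding coeff_sum by (intro sum.cong) (auto simp del: mult_pCons_left split: if_splits)
  also have "\<dots> = (if (i, j) \<in> jets k then c i j else 0)"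
    by simp
  finally show ?thesis by (simp add: jets_def)
qed

text \<open>A product of \<open>K\<close>-th powers of linear forms through the other points kills
  their jets and is a unit at the chosen point. Dividing \<open>\<tau>\<close> by this unit leaves a
  jet that can be lifted to a form. The degree bound leaves room for both factors.\<close>

lemma prescribed_jets:
  assumes fin: "finite I" and p: "(i, a) \<in> I"
    and inj: "inj_on (\<lambda>(i, a). proj_pt (affine_chart i a)) I"
    and d: "d \<ge> K + K * card I"
  obtains H where "homogeneous d H" "vanishes K (loc i a H - \<tau>)"
    "\<And>j b. (j, b) \<in> I \<Longrightarrow> (j, b) \<noteq> (i, a) \<Longrightarrow> vanishes K (loc j b H)"
proof -
  let ?J = "I - {(i, a)}"
  have "\<forall>q\<in>?J. \<exists>L. homogeneous 1 L \<and> coeff2 (loc i a L) 0 0 \<noteq> 0 \<and> coeff2 (loc (fst q) (snd q) L) 0 0 = 0"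
  proof
    fix q assume q: "q \<in> ?J"
    then have "proj_pt (affine_chart i a) \<noteq> proj_pt (affine_chart (fst q) (snd q))"
      using inj_onD[OF inj, of "(i, a)" q] p by (auto simp: case_prod_unfold)
    then show "\<exists>L. homogeneous 1 L \<and> coeff2 (loc i a L) 0 0 \<noteq> 0 \<and> coeff2 (loc (fst q) (snd q) L) 0 0 = 0"
      by (metis separating_linear_form)
  qed
  then obtain L where L: "\<And>q. q \<in> ?J \<Longrightarrow> homogeneous 1 (L q)"
    "\<And>q. q \<in> ?J \<Longrightarrow> coeff2 (loc i a (L q)) 0 0 \<noteq> 0"
    "\<And>q. q \<in> ?J \<Longrightarrow> coeff2 (loc (fst q) (snd q) (L q)) 0 0 = 0"
    by metis
  define M where "M = (\<Prod>q\<in>?J. L q) ^ K"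
  define D' where "D' = card ?J * K"
  have hM: "homogeneous D' M"
    unfolding M_def D'_def using homogeneous_power[OF homogeneous_prod[of ?J 1 L], of K] L(1) by simp
  have "D' \<le> K * card I" 
    unfolding D'_def using fin by (simp add: card_Diff1_le)
  then have D': "D' + K \<le> d" using d by linarith
  have "coeff2 (loc i a M) 0 0 \<noteq> 0"
  proof -
    have c0: "coeff2 (f * g) 0 0 = coeff2 f 0 0 * coeff2 g 0 0" for f g
      by (simp add: coeff_mult)
    have "coeff2 (\<Prod>q\<in>X. loc i a (L q)) 0 0 \<noteq> 0" if "X \<subseteq> ?J" for X
      using that by (induction X rule: infinite_finite_induct) (auto simp: c0 L(2))
    then have *: "coeff2 (\<Prod>q\<in>?J. loc i a (L q)) 0 0 \<noteq> 0" by blast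
    have "coeff2 ((\<Prod>q\<in>?J. loc i a (L q)) ^ m) 0 0 \<noteq> 0" for m
      using * by (induction m) (auto simp: c0)
    then show ?thesis by (simp add: M_def loc_power loc_prod)
  qed
  then obtain \<sigma> where \<sigma>: "vanishes K (loc i a M * \<sigma> - \<tau>)" by (rule truncated_division)
  obtain S T U where STU: "homogeneous 1 S" "homogeneous 1 T" "homogeneous 1 U"
    "loc i a S = Y2" "loc i a T = Z2" "loc i a U = 1" by (rule local_coordinates)
  \<comment> \<open>\<open>N\<close> homogenises the jet of the quotient \<open>\<sigma>\<close>;
    the power of \<open>U\<close> fills up the degree and is invisible locally.\<close>
  define N where "N = (\<Sum>(x, y)\<in>jets K. scale3 (coeff2 \<sigma> x y) (S ^ x * T ^ y * U ^ (d - D' - x - y)))"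
  have hN: "homogeneous (d - D') N"
    unfolding N_def
  proof (intro homogeneous_sum, safe)
    fix x y assume "(x, y) \<in> jets K"
    then have *: "x + y < K" by (simp add: jets_def)
    have "homogeneous (1 * x + 1 * y + 1 * (d - D' - x - y)) (S ^ x * T ^ y * U ^ (d - D' - x - y))"
      by (intro homogeneous_mult homogeneous_power STU)
    also have "1 * x + 1 * y + 1 * (d - D' - x - y) = d - D'"
      using * D' by linarith
    finally show "homogeneous (d - D') (scale3 (coeff2 \<sigma> x y) (S ^ x * T ^ y * U ^ (d - D' - x - y)))"
      by (rule homogeneous_scale)
  qed
  have "vanishes K (loc i a N - \<sigma>)"
    unfolding N_def loc_sum vanishes_def coeff_diff
    by (auto simp: case_prod_unfold loc_scale loc_mult loc_power STU
        coeff2_jet_sum[of "coeff2 \<sigma>", unfolded case_prod_unfold] simp del: mult_pCons_left)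
  then have "vanishes K (loc i a M * loc i a N - loc i a M * \<sigma>)"
    using vanishes_mult_left by (metis right_diff_distrib)
  show thesis
  proof
    have "homogeneous (D' + (d - D')) (M * N)" by (intro homogeneous_mult hM hN)
    with D' show "homogeneous d (M * N)" by simp
    show "vanishes K (loc i a (M * N) - \<tau>)"
      using \<open>vanishes K (loc i a M * loc i a N - loc i a M * \<sigma>)\<close> \<sigma> unfolding loc_mult
      by (rule vanishes_trans)
    fix j b assume q: "(j, b) \<in> I" "(j, b) \<noteq> (i, a)"
    then have "(j, b) \<in> ?J" by blast
    with fin have "(\<Prod>q\<in>?J. L q) = L (j, b) * (\<Prod>q\<in>?J - {(j, b)}. L q)"
      by (intro prod.remove) auto
    then have "vanishes 1 (loc j b (\<Prod>q\<in>?J. L q))"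
      using L(3)[OF \<open>(j, b) \<in> ?J\<close>] by (auto simp: loc_mult vanishes_1[symmetric] intro: vanishes_mult_right)
    then show "vanishes K (loc j b (M * N))"
      unfolding M_def loc_mult loc_power by (intro vanishes_mult_right vanishes_power)
  qed
qed

section \<open>A Bezout inequality with local contributions\<close>

text \<open>Families instead of sets allow disjoint sums as index sets. Injectivity comes from the
  independence hypothesis itself: a repeated value would give a relation with coefficients 1 and
  -1.\<close>

lemma (in vector_space) family_card_le:
  assumes fin: "finite I" "finite T" and span: "\<And>i. i \<in> I \<Longrightarrow> f i \<in> span T"
    and indep: "\<And>c i. (\<Sum>i\<in>I. scale (c i) (f i)) = 0 \<Longrightarrow> i \<in> I \<Longrightarrow> c i = 0"
  shows "card I \<le> card T"
proof -
  have inj: "inj_on f I"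
  proof (rule inj_onI, rule ccontr)
    fix x y assume xy: "x \<in> I" "y \<in> I" "f x = f y" "x \<noteq> y"
    let ?c = "\<lambda>i. if i = x then 1 else if i = y then - 1 else 0"
    have "(\<Sum>i\<in>I. scale (?c i) (f i)) = (\<Sum>i\<in>{x, y}. scale (?c i) (f i))"
      using xy fin(1) by (intro sum.mono_neutral_right) auto
    also have "\<dots> = 0" using xy by simp
    finally show False using indep[of ?c x] xy by simp
  qed
  have "independent (f ` I)"
    unfolding dependent_finite[OF finite_imageI[OF fin(1)]]
  proof (safe)
    fix u i assume u: "(\<Sum>v\<in>f ` I. scale (u v) v) = 0" "i \<in> I" "u (f i) \<noteq> 0"
    then show False using indep[of "\<lambda>i. u (f i)" i] by (simp add: sum.reindex[OF inj])
  qed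
  then have "card (f ` I) \<le> card T"
    using independent_span_bound[OF fin(2)] span by blast
  then show ?thesis by (simp add: card_image[OF inj])
qed

text \<open>Modulo the k-th power of the maximal ideal, (f, g) is spanned by e elements and hence has codimension
  at least r.\<close>

definition local_codim_ge :: "poly2 \<Rightarrow> poly2 \<Rightarrow> nat \<Rightarrow> bool" where
  "local_codim_ge f g r \<longleftrightarrow> (\<exists>k e \<epsilon>. e + r \<le> card (jets k) \<and>
     (\<forall>u v. \<exists>c. vanishes k (u * f + v * g - (\<Sum>l<e. const2 (c l) * \<epsilon> l))))"

text \<open>In the large degree \<open>d\<close> the ideal of \<open>F\<close> and \<open>G\<close>
  has codimension \<open>n * m\<close>, by counting monomials. Locally its elements satisfy at least
  \<open>r p\<close> linear conditions at each point, and conditions at different points are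
  independent.\<close>

lemma bezout_inequality:
  assumes F: "homogeneous n F" "prime_elem F" and G: "homogeneous m G" and ndvd: "\<not> F dvd G"
    and fin: "finite I" and inj: "inj_on (\<lambda>(i, a). proj_pt (affine_chart i a)) I"
    and codim: "\<And>i a. (i, a) \<in> I \<Longrightarrow> local_codim_ge (loc i a F) (loc i a G) (r (i, a))"
  shows "(\<Sum>p\<in>I. r p) \<le> n * m"
proof -
  let ?loc = "\<lambda>p. loc (fst p) (snd p)"
  have "\<forall>p\<in>I. \<exists>k e \<epsilon>. e + r p \<le> card (jets k) \<and>
     (\<forall>u v. \<exists>c. vanishes k (u * ?loc p F + v * ?loc p G - (\<Sum>l<e. const2 (c l) * \<epsilon> l)))"
  proof
    fix p assume "p \<in> I"
    then show "\<exists>k e \<epsilon>. e + r p \<le> card (jets k) \<and>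
      (\<forall>u v. \<exists>c. vanishes k (u * ?loc p F + v * ?loc p G - (\<Sum>l<e. const2 (c l) * \<epsilon> l)))"
      using codim[of "fst p" "snd p"] by (simp only: local_codim_ge_def prod.collapse)
  qed
  then obtain k e \<epsilon> where "\<forall>p\<in>I. e p + r p \<le> card (jets (k p)) \<and>
     (\<forall>u v. \<exists>c. vanishes (k p) (u * ?loc p F + v * ?loc p G - (\<Sum>l<e p. const2 (c l) * \<epsilon> p l)))"
    unfolding bchoice_iff by blast
  then have ke: "\<And>p. p \<in> I \<Longrightarrow> e p + r p \<le> card (jets (k p))"
    and \<epsilon>: "\<And>p u v. p \<in> I \<Longrightarrow>
      \<exists>c. vanishes (k p) (u * ?loc p F + v * ?loc p G - (\<Sum>l<e p. const2 (c l) * \<epsilon> p l))"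
    by blast+
  define K where "K = (\<Sum>p\<in>I. k p)"
  have kK: "k p \<le> K" if "p \<in> I" for p
    unfolding K_def using fin that by (intro member_le_sum) auto
  \<comment> \<open>The summand \<open>K + K * card I\<close> is what \<open>prescribed_jets\<close>
    requires; \<open>n + m\<close> makes room for multiples of \<open>F\<close>, of \<open>G\<close>
    and of their product.\<close>
  define d where "d = n + m + (K + K * card I)"
  define t where "t = K + K * card I"
  have "\<exists>H. homogeneous d H \<and> vanishes K (?loc p H - \<tau>) \<and>
      (\<forall>q\<in>I. q \<noteq> p \<longrightarrow> vanishes K (?loc q H))" if "p \<in> I" for p \<tau>
    by (rule prescribed_jets[OF fin _ inj, of "fst p" "snd p" K d \<tau>])
      (use that in \<open>auto simp: d_def\<close>)
  then obtain J where J: "\<And>p \<tau>. p \<in> I \<Longrightarrow> homogeneous d (J p \<tau>)"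
    "\<And>p \<tau>. p \<in> I \<Longrightarrow> vanishes K (?loc p (J p \<tau>) - \<tau>)"
    "\<And>p q \<tau>. p \<in> I \<Longrightarrow> q \<in> I \<Longrightarrow> q \<noteq> p \<Longrightarrow> vanishes K (?loc q (J p \<tau>))"
    by metis
  \<comment> \<open>\<open>V\<close> consists of the forms whose jets vanish at all points; its
    dimension \<open>card B\<close> is eliminated between the two estimates \<open>upper\<close> and
    \<open>lower\<close>.\<close>
  define V where "V = {H. homogeneous d H \<and> (\<forall>p\<in>I. vanishes (k p) (?loc p H))}"
  obtain B where B: "B \<subseteq> V" "poly3.independent B" "V \<subseteq> poly3.span B"
    by (rule poly3.maximal_independent_subset)
  have finB: "finite B"
    using poly3.independent_span_bound[of "mon3 ` exps d" B] B(1,2) homogeneous_in_span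
    by (auto simp: V_def)

  \<comment> \<open>The forms with prescribed monomial jets are independent modulo \<open>V\<close>:
    taking the jet of a relation at one point removes \<open>V\<close> and the contributions of all
    other points.\<close>
  have upper: "card B + (\<Sum>p\<in>I. card (jets (k p))) \<le> card (exps d)"
  proof -
    let ?I = "B <+> (SIGMA p:I. jets (k p))"
    let ?f = "case_sum (\<lambda>b. b) (\<lambda>(p, x, y). J p (Y2 ^ x * Z2 ^ y))"
    have "card ?I \<le> card (mon3 ` exps d)"
    proof (rule poly3.family_card_le)
      show "finite ?I" using finB fin by auto
      show "?f i \<in> poly3.span (mon3 ` exps d)" if "i \<in> ?I" for i
        using that B(1) J(1) by (intro homogeneous_in_span) (auto simp: V_def)
      fix c i assume "(\<Sum>i\<in>?I. scale3 (c i) (?f i)) = 0" and i: "i \<in> ?I"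
      then have 0: "(\<Sum>b\<in>B. scale3 (c (Inl b)) b) +
          (\<Sum>p\<in>I. \<Sum>(x, y)\<in>jets (k p). scale3 (c (Inr (p, x, y))) (J p (Y2 ^ x * Z2 ^ y))) = 0"
        using finB fin by (simp add: sum.Plus sum.Sigma case_prod_unfold)
      have cr: "c (Inr (p, x, y)) = 0" if p: "p \<in> I" and xy: "(x, y) \<in> jets (k p)" for p x y
      proof -
        let ?s = "\<lambda>p. \<Sum>(x, y)\<in>jets (k p). scale3 (c (Inr (p, x, y))) (J p (Y2 ^ x * Z2 ^ y))"
        let ?u = "\<Sum>(x, y)\<in>jets (k p). const2 (c (Inr (p, x, y))) * (Y2 ^ x * Z2 ^ y)"
        have 1: "vanishes (k p) (?loc p (\<Sum>b\<in>B. scale3 (c (Inl b)) b))"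
          unfolding loc_sum loc_scale
          using B(1) p by (intro vanishes_sum vanishes_mult_left) (auto simp: V_def)
        have 2: "vanishes (k p) (?loc p (\<Sum>q\<in>I - {p}. ?s q))"
          unfolding loc_sum
          using p by (auto simp: loc_sum loc_scale simp del: mult_pCons_left
              intro!: vanishes_sum vanishes_mult_left vanishes_mono[OF J(3) kK])
        have "vanishes K (?loc p (?s p) - ?u)"
        proof -
          have "?loc p (?s p) - ?u = (\<Sum>(x, y)\<in>jets (k p). const2 (c (Inr (p, x, y))) *
              (?loc p (J p (Y2 ^ x * Z2 ^ y)) - Y2 ^ x * Z2 ^ y))"
            by (simp add: loc_sum case_prod_unfold loc_scale sum_subtractf right_diff_distrib
                del: mult_pCons_left)
          then show ?thesis
            using J(2)[OF p] by (auto intro!: vanishes_sum vanishes_mult_left simp del: mult_pCons_left)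
        qed
        then have 3: "vanishes (k p) (?loc p (?s p) - ?u)"
          using kK[OF p] vanishes_mono by blast
        have "(\<Sum>p\<in>I. ?s p) = ?s p + (\<Sum>q\<in>I - {p}. ?s q)"
          using fin p by (rule sum.remove)
        then have total: "?loc p (\<Sum>b\<in>B. scale3 (c (Inl b)) b) + (?loc p (?s p) + ?loc p (\<Sum>q\<in>I - {p}. ?s q)) = 0"
          using arg_cong[OF 0, of "?loc p"] by (simp only: loc_add loc_0)
        \<comment> \<open>Each of the three summands on the right has order at least
          \<open>k p\<close>, hence so has the jet combination \<open>?u\<close>, whose coefficients
          are the unknown \<open>c\<close>.\<close>
        have "- ?u = ?loc p (\<Sum>b\<in>B. scale3 (c (Inl b)) b) + ?loc p (\<Sum>q\<in>I - {p}. ?s q)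
             + (?loc p (?s p) - ?u)"
          using total by (simp add: algebra_simps del: mult_pCons_left)
        then have "vanishes (k p) (- ?u)"
          using 1 2 3 by (simp only: vanishes_add)
        then have "vanishes (k p) ?u" using vanishes_uminus by fastforce
        moreover have "x + y < k p" using xy by (simp add: jets_def)
        ultimately have "coeff2 ?u x y = 0" unfolding vanishes_def by blast
        then show ?thesis
          unfolding coeff2_jet_sum[of "\<lambda>x y. c (Inr (p, x, y))"] using \<open>x + y < k p\<close> by simp
      qed
      then have "(\<Sum>p\<in>I. \<Sum>(x, y)\<in>jets (k p). scale3 (c (Inr (p, x, y))) (J p (Y2 ^ x * Z2 ^ y))) = 0"
        by (auto intro!: sum.neutral)
      with 0 have "(\<Sum>b\<in>B. scale3 (c (Inl b)) b) = 0" by simp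
      then have "c (Inl b) = 0" if "b \<in> B" for b
        using poly3.independentD[OF B(2) finB subset_refl, of "\<lambda>b. c (Inl b)"] that by blast
      with cr i show "c i = 0" by auto
    qed auto
    also note card_mon3_le
    finally show ?thesis using finB fin by (simp add: card_Plus)
  qed

  have F0: "F \<noteq> 0" using F(2) by auto
  \<comment> \<open>\<open>G\<close> is multiplied only by standard monomials modulo
    \<open>F\<close>, which excludes the syzygy \<open>G * F = F * G\<close>.\<close>
  let ?E = "exps_not_dvd (lead_exp F) (d - m)"
  have finE: "finite ?E" using exps_not_dvd_subset finite_exps by (rule finite_subset)
  have lower: "card (exps (d - n)) + card ?E \<le> card B + (\<Sum>p\<in>I. e p)"
  proof -
    let ?I = "exps (d - n) <+> ?E"
    let ?f = "case_sum (\<lambda>t. F * mon3 t) (\<lambda>t. G * mon3 t)"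
    let ?T = "B \<union> (\<lambda>(p, l). J p (\<epsilon> p l)) ` (SIGMA p:I. {..<e p})"
    have finT: "finite ?T" using finB fin by auto
    \<comment> \<open>Subtracting lifts of the \<open>\<epsilon>\<close> with the local coefficients
      moves an element of the ideal into \<open>V\<close>. Hence the ideal needs at most
      \<open>e p\<close> further dimensions at each point.\<close>
    have ideal: "W \<in> poly3.span ?T" if W: "homogeneous d W" "W = F * P + G * Q" for W P Q
    proof -
      have "\<forall>p\<in>I. \<exists>c. vanishes (k p) (?loc p W - (\<Sum>l<e p. const2 (c l) * \<epsilon> p l))"
      proof
        fix p assume "p \<in> I"
        have "?loc p W = ?loc p P * ?loc p F + ?loc p Q * ?loc p G"
          by (simp add: W(2) loc_add loc_mult mult.commute)
        then show "\<exists>c. vanishes (k p) (?loc p W - (\<Sum>l<e p. const2 (c l) * \<epsilon> p l))"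
          using \<epsilon>[OF \<open>p \<in> I\<close>, of "?loc p P" "?loc p Q"] by simp
      qed
      then obtain c where c: "\<And>p. p \<in> I \<Longrightarrow> vanishes (k p) (?loc p W - (\<Sum>l<e p. const2 (c p l) * \<epsilon> p l))"
        unfolding bchoice_iff by blast
      let ?s = "\<lambda>p. \<Sum>l<e p. scale3 (c p l) (J p (\<epsilon> p l))"
      define R where "R = (\<Sum>p\<in>I. ?s p)"
      have hR: "homogeneous d R"
        unfolding R_def using J(1) by (intro homogeneous_sum homogeneous_scale) auto
      have "R \<in> poly3.span ?T"
        unfolding R_def by (intro poly3.span_sum poly3.span_scale poly3.span_base) auto
      moreover have "W - R \<in> V"
        unfolding V_def
      proof (safe)
        have "homogeneous d (W + scale3 (- 1) R)" by (intro homogeneous_add homogeneous_scale W hR)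
        then show "homogeneous d (W - R)" by simp
        fix i a assume p: "(i, a) \<in> I"
        let ?p = "(i, a)"
        have "vanishes K (\<Sum>q\<in>I - {?p}. ?loc ?p (?s q))"
          using J(3)[OF _ p] by (intro vanishes_sum) (auto simp: loc_scale loc_sum simp del: mult_pCons_left intro!: vanishes_sum vanishes_mult_left)
        then have 2: "vanishes (k ?p) (\<Sum>q\<in>I - {?p}. ?loc ?p (?s q))"
          using kK[OF p] vanishes_mono by blast
        have "?loc ?p (?s ?p) - (\<Sum>l<e ?p. const2 (c ?p l) * \<epsilon> ?p l) =
            (\<Sum>l<e ?p. const2 (c ?p l) * (?loc ?p (J ?p (\<epsilon> ?p l)) - \<epsilon> ?p l))"
          by (simp add: loc_sum loc_scale sum_subtractf right_diff_distrib del: mult_pCons_left)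
        then have "vanishes K (?loc ?p (?s ?p) - (\<Sum>l<e ?p. const2 (c ?p l) * \<epsilon> ?p l))"
          using J(2)[OF p] by (auto intro!: vanishes_sum vanishes_mult_left simp del: mult_pCons_left)
        then have 3: "vanishes (k ?p) (?loc ?p (?s ?p) - (\<Sum>l<e ?p. const2 (c ?p l) * \<epsilon> ?p l))"
          using kK[OF p] vanishes_mono by blast
        have "?loc ?p R = ?loc ?p (?s ?p) + (\<Sum>q\<in>I - {?p}. ?loc ?p (?s q))"
          unfolding R_def loc_sum[of _ _ ?s] using fin p by (rule sum.remove)
        moreover have "?loc ?p (W - R) = ?loc ?p W - ?loc ?p R"
          using loc_add[of i a "W - R" R] by simp
        moreover have "x - (y + z) = (x - s) - (y - s) - z" for x y z s :: poly2 by simp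
        ultimately have "?loc ?p (W - R) = (?loc ?p W - (\<Sum>l<e ?p. const2 (c ?p l) * \<epsilon> ?p l))
          - (?loc ?p (?s ?p) - (\<Sum>l<e ?p. const2 (c ?p l) * \<epsilon> ?p l))
          - (\<Sum>q\<in>I - {?p}. ?loc ?p (?s q))"
          by (simp only:)
        then have "vanishes (k ?p) (?loc ?p (W - R))"
          using c[OF p] 2 3 by (simp only: vanishes_diff)
        then show "vanishes (k (i, a)) (loc (fst ?p) (snd ?p) (W - R))" by simp
      qed
      then have "W - R \<in> poly3.span ?T"
        using B(3) poly3.span_mono[of B ?T] by blast
      ultimately show ?thesis using poly3.span_add by fastforce
    qed
    have "card ?I \<le> card ?T"
    proof (rule poly3.family_card_le)
      show "finite ?I" using finE by auto
      show "finite ?T" by (rule finT)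
      show "?f x \<in> poly3.span ?T" if x: "x \<in> ?I" for x
      proof (cases x)
        case (Inl t)
        with x have "homogeneous (n + (d - n)) (F * mon3 t)"
          by (intro homogeneous_mult F homogeneous_mon3) auto
        then show ?thesis
          using ideal[of "F * mon3 t" "mon3 t" 0] by (simp add: Inl d_def add.assoc)
      next
        case (Inr t)
        with x have "t \<in> exps (d - m)"
          using exps_not_dvd_subset[of "lead_exp F" "d - m"] by auto
        then have "homogeneous (m + (d - m)) (G * mon3 t)"
          by (intro homogeneous_mult G homogeneous_mon3)
        then show ?thesis
          using ideal[of "G * mon3 t" 0 "mon3 t"] by (simp add: Inr d_def ac_simps)
      qed
      fix c x assume "(\<Sum>i\<in>?I. scale3 (c i) (?f i)) = 0" and x: "x \<in> ?I"
      moreover define P where "P = (\<Sum>t\<in>exps (d - n). scale3 (c (Inl t)) (mon3 t))"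
      moreover define Q where "Q = (\<Sum>t\<in>?E. scale3 (c (Inr t)) (mon3 t))"
      ultimately have 0: "F * P + G * Q = 0"
        using finE by (simp add: sum.Plus sum_distrib_left)
      then have "G * Q = F * (- P)" by (simp add: add_eq_0_iff)
      then have "F dvd G * Q" by simp
      \<comment> \<open>Primality passes the divisibility on to \<open>Q\<close>, a combination of
        standard monomials, which must therefore be zero.\<close>
      with ndvd F(2) have "F dvd Q" by (simp add: prime_elem_dvd_mult_iff)
      then have cr: "c (Inr t) = 0" if "t \<in> ?E" for t
        unfolding Q_def using multiple_not_in_exps_not_dvd[of F "\<lambda>t. c (Inr t)"] that by blast
      then have "Q = 0" unfolding Q_def by (intro sum.neutral) auto
      with 0 F0 have "P = 0" by simp
      have "c (Inl t) = 0" if "t \<in> exps (d - n)" for t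
        using coeff3_sum_mon3[OF finite_exps, of "\<lambda>t. c (Inl t)" "d - n" "fst t" "fst (snd t)" "snd (snd t)"]
          that \<open>P = 0\<close> unfolding P_def by simp
      with cr x show "c x = 0" by auto
    qed
    also have "card ?T \<le> card B + card ((\<lambda>(p, l). J p (\<epsilon> p l)) ` (SIGMA p:I. {..<e p}))"
      by (rule card_Un_le)
    also have "\<dots> \<le> card B + card (SIGMA p:I. {..<e p})"
      using fin by (intro add_left_mono card_image_le) auto
    finally show ?thesis using finE fin by (simp add: card_Plus)
  qed

  have "card ?E + card (exps t) = card (exps (n + t))"
    using card_exps_not_dvd[OF lead_exp_homogeneous[OF F(1) F0], of t] by (simp add: d_def t_def)
  moreover have "d - n = m + t" "d = n + m + t" by (auto simp: d_def t_def)
  ultimately have "card (exps (m + t)) + card (exps (n + t)) \<le> card (exps t) + card B + (\<Sum>p\<in>I. e p)"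
    using lower by simp
  moreover have "(\<Sum>p\<in>I. e p) + (\<Sum>p\<in>I. r p) \<le> (\<Sum>p\<in>I. card (jets (k p)))"
    unfolding sum.distrib[symmetric] using ke by (intro sum_mono) auto
  ultimately have "2 * card (exps (m + t)) + 2 * card (exps (n + t)) + 2 * (\<Sum>p\<in>I. r p)
      \<le> 2 * card (exps t) + 2 * card (exps d)"
    using upper by linarith
  \<comment> \<open>The terms in \<open>t\<close> cancel: with g(s) = (s + 1)(s + 2), the sum g(t) +
    g(n + m + t) - g(m + t) - g(n + t) equals 2nm.\<close>
  then show ?thesis
    unfolding card_exps \<open>d = n + m + t\<close> by (simp add: algebra_simps)
qed

section \<open>Polar curves and their local expansions\<close>

text \<open>The derivative of \<open>F\<close> in the direction \<open>v\<close>; its zero set is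
  the first polar curve of the point \<open>v\<close>.\<close>

definition polar :: "complex^3 \<Rightarrow> poly3 \<Rightarrow> poly3" where
  "polar v F = scale3 (v $ 1) (partial_x F) + scale3 (v $ 2) (partial_y F) + scale3 (v $ 3) (partial_z F)"

lemma coeff_of_nat_times: "coeff (of_nat m * p) i = of_nat m * coeff p i"
  by (simp add: of_nat_poly)

lemma coeff3_partial:
  "coeff3 (partial_x F) i j k = of_nat (Suc i) * coeff3 F (Suc i) j k"
  "coeff3 (partial_y F) i j k = of_nat (Suc j) * coeff3 F i (Suc j) k"
  "coeff3 (partial_z F) i j k = of_nat (Suc k) * coeff3 F i j (Suc k)"
  by (simp_all only: partial_x_def partial_y_def partial_z_def coeff_pderiv coeff_map_poly
      pderiv_0 map_poly_0 coeff_of_nat_times)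

lemma homogeneous_polar:
  assumes "homogeneous n F"
  shows "homogeneous (n - 1) (polar v F)"
  unfolding polar_def using assms
  by (intro homogeneous_add homogeneous_scale)
    (unfold homogeneous_def coeff3_partial, (metis add_Suc add_Suc_right diff_Suc_1 mult_zero_right)+)

lemma euler_identity:
  assumes "homogeneous n F"
  shows "X3 * partial_x F + Y3 * partial_y F + Z3 * partial_z F = scale3 (of_nat n) F"
proof (rule poly3_eqI)
  fix i j k
  have "coeff3 (X3 * partial_x F) i j k = of_nat i * coeff3 F i j k"
    by (cases i) (simp_all add: coeff3_partial del: of_nat_Suc)
  moreover have "coeff3 (Y3 * partial_y F) i j k = of_nat j * coeff3 F i j k"
    by (cases j) (simp_all add: coeff3_partial del: of_nat_Suc)
  moreover have "coeff3 (Z3 * partial_z F) i j k = of_nat k * coeff3 F i j k"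
    by (cases k) (simp_all add: coeff3_partial del: of_nat_Suc)
  moreover have "(of_nat i + of_nat j + of_nat k) * coeff3 F i j k = of_nat n * coeff3 F i j k"
    using assms unfolding homogeneous_def by (metis mult_zero_right of_nat_add)
  ultimately show "coeff3 (X3 * partial_x F + Y3 * partial_y F + Z3 * partial_z F) i j k =
      coeff3 (scale3 (of_nat n) F) i j k"
    unfolding coeff3_scale coeff_add by (simp only: distrib_right)
qed

abbreviation dY :: "poly2 \<Rightarrow> poly2" where "dY \<equiv> pderiv"
abbreviation dZ :: "poly2 \<Rightarrow> poly2" where "dZ \<equiv> map_poly pderiv"

lemma coeff2_deriv:
  "coeff2 (dY f) i j = of_nat (Suc i) * coeff2 f (Suc i) j"
  "coeff2 (dZ f) i j = of_nat (Suc j) * coeff2 f i (Suc j)"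
  by (simp_all only: coeff_pderiv coeff_map_poly pderiv_0 coeff_of_nat_times)

lemma dZ_add: "dZ (f + g) = dZ f + dZ g"
  by (rule poly2_eqI) (simp add: coeff2_deriv algebra_simps del: of_nat_Suc)

lemma dZ_mult: "dZ (f * g) = f * dZ g + g * dZ f"
proof -
  have smult: "dZ (smult p g) = smult (pderiv p) g + smult p (dZ g)" for p g
    by (rule poly_eqI) (simp add: coeff_map_poly pderiv_mult algebra_simps)
  show ?thesis
    by (induction f) (simp_all add: dZ_add smult map_poly_pCons algebra_simps)
qed

lemma hom3_variables:
  "hom3 r1 r2 r3 X3 = r1" "hom3 r1 r2 r3 Y3 = r2" "hom3 r1 r2 r3 Z3 = r3"
  using ring_hom_subst_hom[of const2] ring_hom_subst_hom[of "subst_hom const2 r3"] ring_hom_const2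
  by (simp_all add: hom3_pCons ring_hom_def)

text \<open>Two of the partial derivatives of the form expand to \<open>dY\<close> and
  \<open>dZ\<close>, and Euler's identity expresses the third through them. Here
  \<open>\<pi>\<close> is the coordinate of \<open>v\<close> that the chart sets to 1, and
  \<open>\<alpha>\<close>, \<open>\<beta>\<close> are the remaining coordinates of \<open>v\<close>
  minus \<open>\<pi>\<close> times the centre, so both vanish when \<open>v\<close> is the
  centre.\<close>

lemma loc_euler:
  assumes F: "homogeneous n F"
  obtains \<pi> \<alpha> \<beta> where
    "loc i a (polar v F) = const2 (\<pi> * of_nat n) * loc i a F + const2 \<alpha> * dY (loc i a F)
       + const2 \<beta> * dZ (loc i a F) - const2 \<pi> * (Y2 * dY (loc i a F) + Z2 * dZ (loc i a F))"
    "v = affine_chart i a \<Longrightarrow> \<pi> = 1 \<and> \<alpha> = 0 \<and> \<beta> = 0"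
proof -
  let ?f = "loc i a F" and ?u = "const2 (a $ 1) + Y2" and ?w = "const2 (a $ 2) + Z2"
  let ?x = "loc i a (partial_x F)" and ?y = "loc i a (partial_y F)" and ?z = "loc i a (partial_z F)"
  have pol: "loc i a (polar v F) = const2 (v $ 1) * ?x + const2 (v $ 2) * ?y + const2 (v $ 3) * ?z"
    unfolding polar_def loc_add loc_scale ..
  have eul: "loc i a X3 * ?x + loc i a Y3 * ?y + loc i a Z3 * ?z = const2 (of_nat n) * ?f"
    using arg_cong[OF euler_identity[OF F], of "loc i a"] unfolding loc_add loc_mult loc_scale .
  have dY: "dY 1 = 0" "dY ?u = 1" "dY ?w = 0" and dZ: "dZ 1 = 0" "dZ ?u = 0" "dZ ?w = 1"
    by (simp_all add: pderiv_pCons one_pCons map_poly_pCons)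
  have cY: "dY (const2 c) = 0" and cZ: "dZ (const2 c) = 0" for c
    by (simp_all add: pderiv_pCons map_poly_pCons)
  note drvY = derivation_hom3[of dY, OF pderiv_add pderiv_mult cY]
  note drvZ = derivation_hom3[of dZ, OF dZ_add dZ_mult cZ]
  have const: "const2 (x - y) = const2 x - const2 y" "const2 (x * y) = const2 x * const2 y" for x y
    by simp_all
  have id: "A1 * (N * f - (a1 + Y) * p - (a2 + Z) * q) + A2 * p + A3 * q =
      A1 * N * f + (A2 - A1 * a1) * p + (A3 - A1 * a2) * q - A1 * (Y * p + Z * q)"
    for A1 A2 A3 N f a1 a2 Y Z p q :: poly2
    by (simp add: algebra_simps)
  show thesis
  proof (cases i a rule: loc_cases)
    case 1
    have d: "dY ?f = ?y" "dZ ?f = ?z"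
      using drvY[of 1 ?u ?w F] drvZ[of 1 ?u ?w F] unfolding 1(2) dY dZ by simp_all
    have "loc i a X3 = 1" "loc i a Y3 = ?u" "loc i a Z3 = ?w"
      by (simp_all only: 1(2) hom3_variables)
    with eul have x: "?x = const2 (of_nat n) * ?f - ?u * dY ?f - ?w * dZ ?f"
      unfolding d by (simp only: algebra_simps mult_1_left)
    show thesis
    proof (rule that[of "v $ 1" "v $ 2 - v $ 1 * a $ 1" "v $ 3 - v $ 1 * a $ 2"])
      show "loc i a (polar v F) = const2 (v $ 1 * of_nat n) * ?f + const2 (v $ 2 - v $ 1 * a $ 1) * dY ?f
         + const2 (v $ 3 - v $ 1 * a $ 2) * dZ ?f - const2 (v $ 1) * (Y2 * dY ?f + Z2 * dZ ?f)"
        unfolding const pol x d[symmetric] by (rule id)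
    qed (use 1(1) in \<open>auto simp: affine_chart_def\<close>)
  next
    case 2
    have d: "dY ?f = ?x" "dZ ?f = ?z"
      using drvY[of ?u 1 ?w F] drvZ[of ?u 1 ?w F] unfolding 2(2) dY dZ by simp_all
    have "loc i a X3 = ?u" "loc i a Y3 = 1" "loc i a Z3 = ?w"
      by (simp_all only: 2(2) hom3_variables)
    with eul have x: "?y = const2 (of_nat n) * ?f - ?u * dY ?f - ?w * dZ ?f"
      unfolding d by (simp only: algebra_simps mult_1_left)
    show thesis
    proof (rule that[of "v $ 2" "v $ 1 - v $ 2 * a $ 1" "v $ 3 - v $ 2 * a $ 2"])
      have "loc i a (polar v F) = const2 (v $ 2) * ?y + const2 (v $ 1) * ?x + const2 (v $ 3) * ?z"
        unfolding pol by (simp only: add.commute)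
      then show "loc i a (polar v F) = const2 (v $ 2 * of_nat n) * ?f + const2 (v $ 1 - v $ 2 * a $ 1) * dY ?f
         + const2 (v $ 3 - v $ 2 * a $ 2) * dZ ?f - const2 (v $ 2) * (Y2 * dY ?f + Z2 * dZ ?f)"
        unfolding const x d[symmetric] by (simp only: id)
    qed (use 2(1) in \<open>auto simp: affine_chart_def\<close>)
  next
    case 3
    have d: "dY ?f = ?x" "dZ ?f = ?y"
      using drvY[of ?u ?w 1 F] drvZ[of ?u ?w 1 F] unfolding 3(2) dY dZ by simp_all
    have "loc i a X3 = ?u" "loc i a Y3 = ?w" "loc i a Z3 = 1"
      by (simp_all only: 3(2) hom3_variables)
    with eul have x: "?z = const2 (of_nat n) * ?f - ?u * dY ?f - ?w * dZ ?f"
      unfolding d by (simp only: algebra_simps mult_1_left)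
    show thesis
    proof (rule that[of "v $ 3" "v $ 1 - v $ 3 * a $ 1" "v $ 2 - v $ 3 * a $ 2"])
      have "loc i a (polar v F) = const2 (v $ 3) * ?z + const2 (v $ 1) * ?x + const2 (v $ 2) * ?y"
        unfolding pol by (simp only: ac_simps)
      then show "loc i a (polar v F) = const2 (v $ 3 * of_nat n) * ?f + const2 (v $ 1 - v $ 3 * a $ 1) * dY ?f
         + const2 (v $ 2 - v $ 3 * a $ 2) * dZ ?f - const2 (v $ 3) * (Y2 * dY ?f + Z2 * dZ ?f)"
        unfolding const x d[symmetric] by (simp only: id)
    qed (use 3(1) in \<open>auto simp: affine_chart_def\<close>)
  qed
qed

subsection \<open>Local contributions\<close>

lemma card_jets: "2 * card (jets k) = k * (k + 1)"
proof -
  have "jets k = (SIGMA i:{..<k}. {..<k - i})" by (auto simp: jets_def)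
  then have "card (jets k) = (\<Sum>i<k. k - i)" by simp
  also have "\<dots> = (\<Sum>i<k. Suc i)"
    by (rule sum.reindex_bij_witness[of _ "\<lambda>i. k - Suc i" "\<lambda>i. k - Suc i"]) auto
  also have "2 * \<dots> = k * (k + 1)"
    by (induction k) auto
  finally show ?thesis .
qed

lemma coeff2_Y2_mult: "coeff2 (Y2 * f) i j = (if i = 0 then 0 else coeff2 f (i - 1) j)"
  by (cases i) auto

lemma coeff2_Z2_mult: "coeff2 (Z2 * f) i j = (if j = 0 then 0 else coeff2 f i (j - 1))"
  by (cases j) auto

lemma coeff2_const2_mult: "coeff2 (const2 c * f) i j = c * coeff2 f i j"
  by simp

lemmas coeff2_simps = coeff2_Y2_mult coeff2_Z2_mult coeff2_const2_mult coeff2_deriv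

definition linear_part :: "poly2 \<Rightarrow> poly2" where
  "linear_part f = const2 (coeff2 f 0 0) + const2 (coeff2 f 1 0) * Y2 + const2 (coeff2 f 0 1) * Z2"

lemma vanishes_linear_part: "vanishes 2 (f - linear_part f)"
proof -
  have "(i, j) \<in> {(0, 0), (1, 0), (0, 1)}" if "i + j < 2" for i j :: nat
    using that by auto
  then show ?thesis
    unfolding vanishes_def linear_part_def by (fastforce simp: coeff_pCons split: nat.splits)
qed

lemma vanishes_const_part: "vanishes 1 (f - const2 (coeff2 f 0 0))"
  by (simp add: vanishes_1 del: One_nat_def)

lemma sum_lessThan_4: "(\<Sum>l<(4::nat). h l) = h 0 + h 1 + h 2 + (h 3 :: 'a :: comm_monoid_add)"
  and sum_lessThan_3: "(\<Sum>l<(3::nat). h l) = h 0 + h 1 + (h 2 :: 'a :: comm_monoid_add)"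
  and sum_lessThan_2: "(\<Sum>l<(2::nat). h l) = h 0 + (h 1 :: 'a :: comm_monoid_add)"
  by (simp_all add: eval_nat_numeral ac_simps)

text \<open>Modulo order 2, \<open>f\<close> drops out and only the constant term of the cofactor of
  \<open>g\<close> counts, so the ideal is spanned by \<open>g\<close> alone: the codimension is at
  least 3 - 1.\<close>

lemma local_codim_singular:
  assumes "vanishes 2 f" "vanishes 1 g"
  shows "local_codim_ge f g 2"
  unfolding local_codim_ge_def
proof (intro exI conjI allI)
  show "1 + 2 \<le> card (jets 2)" using card_jets[of 2] by simp
  fix u v
  let ?c = "\<lambda>l::nat. coeff2 v 0 0"
  have "vanishes (1 + 1) ((v - const2 (coeff2 v 0 0)) * g)"
    using assms(2) vanishes_const_part by (rule vanishes_mult[rotated])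
  moreover have "vanishes 2 (u * f)"
    using assms(1) by (rule vanishes_mult_left)
  ultimately have "vanishes 2 (u * f + (v - const2 (coeff2 v 0 0)) * g)"
    by (intro vanishes_add) (simp_all add: numeral_2_eq_2)
  also have "u * f + (v - const2 (coeff2 v 0 0)) * g = u * f + v * g - (\<Sum>l<1. const2 (?c l) * g)"
    by (simp add: algebra_simps)
  finally show "vanishes 2 (u * f + v * g - (\<Sum>l<1. const2 (?c l) * g))" .
qed

text \<open>The quadratic part of \<open>f\<close> is \<open>c\<close> times the square of the
  linear form \<open>l\<close> with coefficients \<open>l1\<close>, \<open>l2\<close>, and the
  linear part of \<open>g\<close> is its derivative in a direction where \<open>l\<close> takes the
  value \<open>s\<close>. If \<open>c * s\<close> is nonzero, \<open>f\<close> agrees with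
  \<open>l * g / (2 * s)\<close> modulo order 3, so the ideal is spanned there by \<open>g\<close>,
  \<open>Y2 * g\<close>, \<open>Z2 * g\<close>. Otherwise \<open>g\<close> has order 2 and
  \<open>f\<close>, \<open>g\<close> suffice. Either way at most 3 of the 6 dimensions are
  lost.\<close>

lemma local_codim_cusp:
  assumes f: "vanishes 2 f" and g: "vanishes 1 g"
    and f2: "coeff2 f 2 0 = c * l1 ^ 2" "coeff2 f 1 1 = 2 * c * l1 * l2" "coeff2 f 0 2 = c * l2 ^ 2"
    and g1: "coeff2 g 1 0 = 2 * c * l1 * s" "coeff2 g 0 1 = 2 * c * l2 * s"
  shows "local_codim_ge f g 3"
proof (cases "c * s = 0")
  case True
  have "vanishes 2 g"
    unfolding vanishes_def
  proof (intro allI impI)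
    fix i j :: nat assume "i + j < 2"
    then have "(i, j) \<in> {(0, 0), (1, 0), (0, 1)}" by auto
    with g[unfolded vanishes_1] g1 True show "coeff2 g i j = 0" by auto
  qed
  show ?thesis
    unfolding local_codim_ge_def
  proof (intro exI conjI allI)
    show "2 + 3 \<le> card (jets 3)" using card_jets[of 3] by simp
    fix u v
    let ?\<epsilon> = "\<lambda>l::nat. if l = 0 then f else g"
    let ?c = "\<lambda>l::nat. if l = 0 then coeff2 u 0 0 else coeff2 v 0 0"
    have "vanishes (1 + 2) ((u - const2 (coeff2 u 0 0)) * f + (v - const2 (coeff2 v 0 0)) * g)"
      by (intro vanishes_add vanishes_mult vanishes_const_part f \<open>vanishes 2 g\<close>)
    also have "(u - const2 (coeff2 u 0 0)) * f + (v - const2 (coeff2 v 0 0)) * g =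
        u * f + v * g - (\<Sum>l<2. const2 (?c l) * ?\<epsilon> l)"
      by (simp add: sum_lessThan_2 algebra_simps)
    finally show "vanishes 3 (u * f + v * g - (\<Sum>l<2. const2 (?c l) * ?\<epsilon> l))"
      by (simp add: numeral_3_eq_3)
  qed
next
  case False
  define h where "h = f - const2 (1 / (2 * s)) * (const2 l1 * (Y2 * g) + const2 l2 * (Z2 * g))"
  have h: "vanishes 3 h"
    unfolding vanishes_def
  proof (intro allI impI)
    fix i j :: nat assume "i + j < 3"
    then have "(i, j) \<in> {(0, 0), (1, 0), (0, 1), (2, 0), (1, 1), (0, 2)}" by auto
    moreover have "coeff2 f 0 0 = 0" "coeff2 f 1 0 = 0" "coeff2 f 0 1 = 0" "coeff2 g 0 0 = 0"
      using f g by (auto simp: vanishes_def)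
    moreover have "coeff2 h i j = coeff2 f i j -
        1 / (2 * s) * (l1 * coeff2 (Y2 * g) i j + l2 * coeff2 (Z2 * g) i j)"
      by (simp only: h_def coeff_diff coeff2_const2_mult coeff_add)
    ultimately show "coeff2 h i j = 0"
      unfolding coeff2_Y2_mult coeff2_Z2_mult using f2 g1 False
      by (elim insertE) (auto simp: field_simps power2_eq_square)
  qed
  show ?thesis
    unfolding local_codim_ge_def
  proof (intro exI conjI allI)
    show "3 + 3 \<le> card (jets 3)" using card_jets[of 3] by simp
    fix u v
    let ?\<epsilon> = "\<lambda>l::nat. if l = 0 then g else if l = 1 then Y2 * g else Z2 * g"
    let ?k = "coeff2 u 0 0 / (2 * s)"
    let ?c = "\<lambda>l::nat. if l = 0 then coeff2 v 0 0 else if l = 1 then coeff2 v 1 0 + ?k * l1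
      else coeff2 v 0 1 + ?k * l2"
    have "vanishes (1 + 2) ((u - const2 (coeff2 u 0 0)) * f)"
      by (intro vanishes_mult vanishes_const_part f)
    then have "vanishes 3 ((u - const2 (coeff2 u 0 0)) * f)" by (simp add: numeral_3_eq_3)
    moreover have "vanishes (2 + 1) ((v - linear_part v) * g)"
      by (intro vanishes_mult vanishes_linear_part g)
    moreover have "vanishes 3 (const2 (coeff2 u 0 0) * h)"
      by (intro vanishes_mult_left h)
    ultimately have "vanishes 3 ((u - const2 (coeff2 u 0 0)) * f + (v - linear_part v) * g
        + const2 (coeff2 u 0 0) * h)"
      by (intro vanishes_add) simp_all
    also have "(u - const2 (coeff2 u 0 0)) * f + (v - linear_part v) * g + const2 (coeff2 u 0 0) * h =
        u * f + v * g - (\<Sum>l<3. const2 (?c l) * ?\<epsilon> l)"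
    proof -
      have c: "const2 (x + ?k * y) = const2 x + const2 (coeff2 u 0 0) * const2 (1 / (2 * s)) * const2 y" for x y
        by simp
      have id: "(u - a) * f + (v - (b0 + b1 * Y + b2 * Z)) * g + a * (f - k * (m1 * (Y * g) + m2 * (Z * g))) =
         u * f + v * g - (b0 * g + (b1 + a * k * m1) * (Y * g) + (b2 + a * k * m2) * (Z * g))"
        for u a v b0 b1 b2 Y Z k m1 m2 :: poly2 by (simp add: algebra_simps)
      have 3: "(\<Sum>l<3. const2 (?c l) * ?\<epsilon> l) = const2 (coeff2 v 0 0) * g +
          const2 (coeff2 v 1 0 + ?k * l1) * (Y2 * g) + const2 (coeff2 v 0 1 + ?k * l2) * (Z2 * g)"
        by (simp add: sum_lessThan_3 del: mult_pCons_left mult_pCons_right)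
      show ?thesis
        unfolding 3 c h_def linear_part_def by (rule id)
    qed
    finally show "vanishes 3 (u * f + v * g - (\<Sum>l<3. const2 (?c l) * ?\<epsilon> l))" .
  qed
qed

text \<open>The ideal is generated by \<open>f\<close>, of order 2, and
  \<open>const2 c * f - g\<close>, of order 3. Modulo order 4 it is spanned by \<open>f\<close>,
  \<open>Y2 * f\<close>, \<open>Z2 * f\<close> and the second generator, which leaves 10 - 4 =
  6.\<close>

lemma local_codim_double_projection:
  assumes f: "vanishes 2 f" and h: "vanishes 3 (const2 c * f - g)"
  shows "local_codim_ge f g 6"
  unfolding local_codim_ge_def
proof (intro exI conjI allI)
  show "4 + 6 \<le> card (jets 4)" using card_jets[of 4] by simp
  fix u v
  \<comment> \<open>The coefficient of \<open>f\<close> in terms of the new generators: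
    \<open>u * f + v * g = w * f - v * ?h\<close>.\<close>
  define w where "w = u + const2 c * v"
  let ?h = "const2 c * f - g"
  let ?\<epsilon> = "\<lambda>l::nat. if l = 0 then f else if l = 1 then Y2 * f else if l = 2 then Z2 * f else ?h"
  let ?c = "\<lambda>l::nat. if l = 0 then coeff2 w 0 0 else if l = 1 then coeff2 w 1 0
    else if l = 2 then coeff2 w 0 1 else - coeff2 v 0 0"
  have "vanishes (2 + 2) ((w - linear_part w) * f)"
    by (intro vanishes_mult vanishes_linear_part f)
  moreover have "vanishes (1 + 3) ((v - const2 (coeff2 v 0 0)) * ?h)"
    by (intro vanishes_mult vanishes_const_part h)
  moreover have "(1 + 3 :: nat) = 4" by simp
  ultimately have "vanishes 4 ((w - linear_part w) * f - (v - const2 (coeff2 v 0 0)) * ?h)"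
    by (intro vanishes_diff) (simp_all only: numeral_plus_numeral add_num_simps)
  also have "(w - linear_part w) * f - (v - const2 (coeff2 v 0 0)) * ?h =
      u * f + v * g - (\<Sum>l<4. const2 (?c l) * ?\<epsilon> l)"
  proof -
    have id: "(u + k * v - (b0 + b1 * Y + b2 * Z)) * f - (v - a) * (k * f - g) =
       u * f + v * g - (b0 * f + b1 * (Y * f) + b2 * (Z * f) + - a * (k * f - g))"
      for u a v b0 b1 b2 Y Z k :: poly2 by (simp add: algebra_simps)
    have 4: "(\<Sum>l<4. const2 (?c l) * ?\<epsilon> l) = const2 (coeff2 w 0 0) * f +
        const2 (coeff2 w 1 0) * (Y2 * f) + const2 (coeff2 w 0 1) * (Z2 * f) + - const2 (coeff2 v 0 0) * ?h"
      by (simp add: sum_lessThan_4 del: mult_pCons_left mult_pCons_right)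
    show ?thesis
      unfolding 4 linear_part_def unfolding w_def by (rule id)
  qed
  finally show "vanishes 4 (u * f + v * g - (\<Sum>l<4. const2 (?c l) * ?\<epsilon> l))" .
qed

section \<open>Analytic equivalence\<close>

lemma has_derivative_vec:
  fixes f :: "'a::real_normed_vector \<Rightarrow> complex^'n"
  assumes "\<And>i. ((\<lambda>x. f x $ i) has_derivative (\<lambda>h. f' h $ i)) F"
  shows "(f has_derivative f') F"
proof -
  have lin: "bounded_linear (\<lambda>c::complex. axis i c :: complex^'n)" for i
    by (rule linear_conv_bounded_linear[THEN iffD1], rule linearI) (auto simp: axis_def vec_eq_iff)
  have sum: "x = (\<Sum>i\<in>UNIV. axis i (x $ i))" for x :: "complex^'n"
    by (simp add: vec_eq_iff axis_def)
  have "((\<lambda>x. \<Sum>i\<in>UNIV. axis i (f x $ i)) has_derivative (\<lambda>h. \<Sum>i\<in>UNIV. axis i (f' h $ i))) F"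
    by (intro has_derivative_sum bounded_linear.has_derivative[OF lin] assms)
  then show ?thesis using sum by simp
qed

lemma holomorphic_mapE:
  assumes "holomorphic_map U \<phi>" "x \<in> U"
  obtains \<phi>' where "(\<phi> has_derivative \<phi>') (at x)" "\<And>c v. \<phi>' (c *s v) = c *s \<phi>' v"
proof -
  have "\<forall>i. \<exists>f'. ((\<lambda>x. \<phi> x $ i) has_derivative f') (at x) \<and> (\<forall>c v. f' (c *s v) = c * f' v)"
    using assms by (auto simp: holomorphic_map_def holomorphic_fun_def)
  then obtain f' where f': "\<And>i. ((\<lambda>x. \<phi> x $ i) has_derivative f' i) (at x)"
    "\<And>i c v. f' i (c *s v) = c * f' i v" by metis
  show thesis
  proof
    show "(\<phi> has_derivative (\<lambda>h. \<chi> i. f' i h)) (at x)"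
      by (rule has_derivative_vec) (simp add: f'(1))
  qed (simp add: vec_eq_iff f'(2))
qed

section \<open>Closure properties of holomorphic functions and maps\<close>

lemma holomorphic_map_open: "holomorphic_map U \<phi> \<Longrightarrow> open U"
  by (auto simp: holomorphic_map_def holomorphic_fun_def)

lemma holomorphic_fun_open: "holomorphic_fun U f \<Longrightarrow> open U"
  by (simp add: holomorphic_fun_def)

lemma holomorphic_funE:
  assumes "holomorphic_fun U f" "x \<in> U"
  obtains f' where "(f has_derivative f') (at x)" "\<And>c v. f' (c *s v) = c * f' v"
  using assms unfolding holomorphic_fun_def by blast

lemma holomorphic_fun_subset: "holomorphic_fun U f \<Longrightarrow> open V \<Longrightarrow> V \<subseteq> U \<Longrightarrow> holomorphic_fun V f"
  unfolding holomorphic_fun_def by blast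

lemma holomorphic_fun_const: "open U \<Longrightarrow> holomorphic_fun U (\<lambda>x. c)"
  unfolding holomorphic_fun_def by (auto intro!: exI[of _ "\<lambda>h. 0"])

lemma holomorphic_fun_nth: "open U \<Longrightarrow> holomorphic_fun U (\<lambda>x. x $ i)"
  unfolding holomorphic_fun_def
  by (auto intro!: exI[of _ "\<lambda>h. h $ i"] bounded_linear_imp_has_derivative)

lemma holomorphic_fun_mult:
  assumes "holomorphic_fun U f" "holomorphic_fun U g"
  shows "holomorphic_fun U (\<lambda>x. f x * g x)"
  unfolding holomorphic_fun_def
proof (intro conjI ballI)
  fix x assume x: "x \<in> U"
  obtain f' where f': "(f has_derivative f') (at x)" "\<And>c v. f' (c *s v) = c * f' v"
    using holomorphic_funE[OF assms(1) x] by blast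
  obtain g' where g': "(g has_derivative g') (at x)" "\<And>c v. g' (c *s v) = c * g' v"
    using holomorphic_funE[OF assms(2) x] by blast
  have "((\<lambda>x. f x * g x) has_derivative (\<lambda>h. f x * g' h + f' h * g x)) (at x)"
    using has_derivative_mult[OF f'(1) g'(1)] .
  then show "\<exists>h'. ((\<lambda>x. f x * g x) has_derivative h') (at x) \<and> (\<forall>c v. h' (c *s v) = c * h' v)"
    by (intro exI conjI) (auto simp: f'(2) g'(2) algebra_simps)
qed (rule holomorphic_fun_open[OF assms(1)])

lemma holomorphic_fun_inverse:
  assumes "holomorphic_fun U f" "\<And>x. x \<in> U \<Longrightarrow> f x \<noteq> 0"
  shows "holomorphic_fun U (\<lambda>x. inverse (f x))"
  unfolding holomorphic_fun_def
proof (intro conjI ballI)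
  fix x assume x: "x \<in> U"
  obtain f' where f': "(f has_derivative f') (at x)" "\<And>c v. f' (c *s v) = c * f' v"
    using holomorphic_funE[OF assms(1) x] by blast
  let ?h = "\<lambda>h. - (inverse (f x) * f' h * inverse (f x))"
  have "((\<lambda>x. inverse (f x)) has_derivative ?h) (at x)"
    by (rule Deriv.has_derivative_inverse[OF assms(2)[OF x] f'(1)])
  moreover have "?h (c *s v) = c * ?h v" for c v
    unfolding f'(2) by (simp only: mult_minus_right ac_simps)
  ultimately show "\<exists>h'. ((\<lambda>x. inverse (f x)) has_derivative h') (at x) \<and> (\<forall>c v. h' (c *s v) = c * h' v)"
    by (intro exI[of _ ?h] conjI allI)
qed (rule holomorphic_fun_open[OF assms(1)])

lemma holomorphic_fun_divide:
  assumes "holomorphic_fun U f" "holomorphic_fun U g" "\<And>x. x \<in> U \<Longrightarrow> g x \<noteq> 0"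
  shows "holomorphic_fun U (\<lambda>x. f x / g x)"
  unfolding divide_inverse
  by (rule holomorphic_fun_mult[OF assms(1) holomorphic_fun_inverse[OF assms(2,3)]])

lemma holomorphic_fun_power:
  assumes "holomorphic_fun U f"
  shows "holomorphic_fun U (\<lambda>x. f x ^ m)"
proof (induction m)
  case 0
  show ?case using holomorphic_fun_const[OF holomorphic_fun_open[OF assms]] by simp
next
  case (Suc m)
  show ?case using holomorphic_fun_mult[OF assms Suc] by simp
qed

lemma holomorphic_fun_compose:
  assumes f: "holomorphic_fun V f" and \<phi>: "holomorphic_map U \<phi>"
    and W: "open W" "W \<subseteq> U" "\<phi> ` W \<subseteq> V"
  shows "holomorphic_fun W (\<lambda>x. f (\<phi> x))"
  unfolding holomorphic_fun_def
proof (intro conjI ballI)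
  fix x assume x: "x \<in> W"
  obtain \<phi>' where \<phi>': "(\<phi> has_derivative \<phi>') (at x)" "\<And>c v. \<phi>' (c *s v) = c *s \<phi>' v"
    using holomorphic_mapE[OF \<phi>] x W by blast
  obtain f' where f': "(f has_derivative f') (at (\<phi> x))" "\<And>c v. f' (c *s v) = c * f' v"
    using holomorphic_funE[OF f] x W by blast
  show "\<exists>h'. ((\<lambda>x. f (\<phi> x)) has_derivative h') (at x) \<and> (\<forall>c v. h' (c *s v) = c * h' v)"
    using has_derivative_compose[OF \<phi>'(1) f'(1)] by (intro exI conjI) (auto simp: \<phi>'(2) f'(2))
qed (rule W)

lemma holomorphic_map_compose:
  assumes "holomorphic_map V \<psi>" "holomorphic_map U \<phi>" "open W" "W \<subseteq> U" "\<phi> ` W \<subseteq> V"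
  shows "holomorphic_map W (\<lambda>x. \<psi> (\<phi> x))"
  unfolding holomorphic_map_def
proof
  fix i
  have "holomorphic_fun V (\<lambda>x. \<psi> x $ i)" using assms(1) by (simp add: holomorphic_map_def)
  then show "holomorphic_fun W (\<lambda>x. \<psi> (\<phi> x) $ i)"
    using assms(2-) by (rule holomorphic_fun_compose)
qed

text \<open>The inverse map carries the inverse unit, transported by \<open>\<psi>\<close>.\<close>

lemma analytically_equivalent_sym:
  assumes "analytically_equivalent f a g b"
  shows "analytically_equivalent g b f a"
proof -
  obtain U V \<phi> \<psi> u where *: "a \<in> U" "b \<in> V" "\<phi> a = b" "homeomorphism U V \<phi> \<psi>"
    "holomorphic_map U \<phi>" "holomorphic_map V \<psi>" "holomorphic_fun U u"
    "\<And>x. x \<in> U \<Longrightarrow> u x \<noteq> 0 \<and> g (\<phi> x) = u x * f x"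
    using assms unfolding analytically_equivalent_def by blast
  have \<psi>: "\<psi> b = a" "\<And>y. y \<in> V \<Longrightarrow> \<psi> y \<in> U" "\<And>y. y \<in> V \<Longrightarrow> \<phi> (\<psi> y) = y"
    using * by (auto simp: homeomorphism_def)
  have "holomorphic_fun V (\<lambda>y. u (\<psi> y))"
    using \<psi>(2) by (intro holomorphic_fun_compose[OF *(7,6) holomorphic_map_open[OF *(6)]]) auto
  then have holu: "holomorphic_fun V (\<lambda>y. inverse (u (\<psi> y)))"
    by (rule holomorphic_fun_inverse) (use *(8) \<psi>(2) in blast)
  have unit: "inverse (u (\<psi> y)) \<noteq> 0 \<and> f (\<psi> y) = inverse (u (\<psi> y)) * g y" if "y \<in> V" for y
    using *(8)[OF \<psi>(2)[OF that]] \<psi>(3)[OF that] by auto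
  show ?thesis
    unfolding analytically_equivalent_def
    by (rule exI[of _ V], rule exI[of _ U], rule exI[of _ \<psi>], rule exI[of _ \<phi>],
        rule exI[of _ "\<lambda>y. inverse (u (\<psi> y))"])
      (intro conjI ballI *(1,2,5,6) \<psi>(1) homeomorphism_symD[OF *(4)] holu unit[THEN conjunct1] unit[THEN conjunct2])
qed

lemma analytically_equivalent_trans:
  assumes "analytically_equivalent f a g b" "analytically_equivalent g b h c"
  shows "analytically_equivalent f a h c"
proof -
  obtain U V \<phi> \<psi> u where 1: "a \<in> U" "b \<in> V" "\<phi> a = b" "homeomorphism U V \<phi> \<psi>"
    "holomorphic_map U \<phi>" "holomorphic_map V \<psi>" "holomorphic_fun U u"
    "\<And>x. x \<in> U \<Longrightarrow> u x \<noteq> 0 \<and> g (\<phi> x) = u x * f x"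
    using assms(1) unfolding analytically_equivalent_def by blast
  obtain U' V' \<phi>' \<psi>' u' where 2: "b \<in> U'" "c \<in> V'" "\<phi>' b = c" "homeomorphism U' V' \<phi>' \<psi>'"
    "holomorphic_map U' \<phi>'" "holomorphic_map V' \<psi>'" "holomorphic_fun U' u'"
    "\<And>x. x \<in> U' \<Longrightarrow> u' x \<noteq> 0 \<and> h (\<phi>' x) = u' x * g x"
    using assms(2) unfolding analytically_equivalent_def by blast
  \<comment> \<open>Both domains are shrunk so that the composites are defined and mutually
    inverse.\<close>
  define W where "W = U \<inter> \<phi> -` U'"
  define W' where "W' = V' \<inter> \<psi>' -` V"
  note opens = holomorphic_map_open[OF 1(5)] holomorphic_map_open[OF 1(6)]
    holomorphic_map_open[OF 2(5)] holomorphic_map_open[OF 2(6)]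
  note h1 = 1(4)[unfolded homeomorphism_def] and h2 = 2(4)[unfolded homeomorphism_def]
  have oW: "open W" "open W'"
    unfolding W_def W'_def using h1 h2 opens by (auto intro!: continuous_open_preimage)
  have sub: "W \<subseteq> U" "\<phi> ` W \<subseteq> U'" "W' \<subseteq> V'" "\<psi>' ` W' \<subseteq> V" by (auto simp: W_def W'_def)
  have hom: "homeomorphism W W' (\<lambda>x. \<phi>' (\<phi> x)) (\<lambda>z. \<psi> (\<psi>' z))"
  proof (rule homeomorphismI)
    show "continuous_on W (\<lambda>x. \<phi>' (\<phi> x))"
      using h1 h2 sub by (intro continuous_on_compose2[of U' \<phi>' W \<phi>]) (auto intro: continuous_on_subset)
    show "continuous_on W' (\<lambda>z. \<psi> (\<psi>' z))"
      using h1 h2 sub by (intro continuous_on_compose2[of V \<psi> W' \<psi>']) (auto intro: continuous_on_subset)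
    show "(\<lambda>x. \<phi>' (\<phi> x)) ` W \<subseteq> W'" "(\<lambda>z. \<psi> (\<psi>' z)) ` W' \<subseteq> W"
      using h1 h2 by (auto simp: W_def W'_def)
    show "\<psi> (\<psi>' (\<phi>' (\<phi> x))) = x" if "x \<in> W" for x
      using h1 h2 that by (auto simp: W_def)
    show "\<phi>' (\<phi> (\<psi> (\<psi>' y))) = y" if "y \<in> W'" for y
      using h1 h2 that by (auto simp: W'_def)
  qed
  have holu: "holomorphic_fun W (\<lambda>x. u' (\<phi> x) * u x)"
    using 1(5,7) 2(7) oW sub
    by (intro holomorphic_fun_mult[of W "\<lambda>x. u' (\<phi> x)" u] holomorphic_fun_compose[of U' u' U \<phi> W]
        holomorphic_fun_subset[of U u W])
  have "a \<in> W" using 1 2 by (auto simp: W_def)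
  moreover have "c \<in> W'" using 1 2 h2 by (auto simp: W'_def)
  moreover have "holomorphic_map W (\<lambda>x. \<phi>' (\<phi> x))" "holomorphic_map W' (\<lambda>z. \<psi> (\<psi>' z))"
    using holomorphic_map_compose[OF 2(5) 1(5) oW(1) sub(1,2)]
      holomorphic_map_compose[OF 1(6) 2(6) oW(2) sub(3,4)] by blast+
  moreover have "\<forall>x\<in>W. u' (\<phi> x) * u x \<noteq> 0 \<and> h (\<phi>' (\<phi> x)) = u' (\<phi> x) * u x * f x"
    using 1(8) 2(8) by (auto simp: W_def)
  moreover have "\<phi>' (\<phi> a) = c" using 1 2 by simp
  ultimately show ?thesis
    unfolding analytically_equivalent_def using hom holu
    by (intro exI[of _ W] exI[of _ W'] exI[of _ "\<lambda>x. \<phi>' (\<phi> x)"] exI[of _ "\<lambda>z. \<psi> (\<psi>' z)"]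
        exI[of _ "\<lambda>x. u' (\<phi> x) * u x"] conjI)
qed

section \<open>Transition maps between affine charts\<close>

lemma eval3_sum: "eval3 (\<Sum>x\<in>X. f x) v = (\<Sum>x\<in>X. eval3 (f x) v)"
  by (simp add: eval3_def poly_sum)

lemma eval3_scaled_mon3:
  "eval3 (scale3 c (mon3 (i, j, k))) v = c * (v $ 1 ^ i * v $ 2 ^ j * v $ 3 ^ k)"
  by (simp add: eval3_def mon3_def poly_monom poly_const_pow)

lemma eval3_scale:
  assumes "homogeneous n F"
  shows "eval3 F (c *s v) = c ^ n * eval3 F v"
proof -
  have "eval3 F w = (\<Sum>(i, j, k)\<in>exps n. coeff3 F i j k * (w $ 1 ^ i * w $ 2 ^ j * w $ 3 ^ k))" for w
    by (subst homogeneous_expansion[OF assms])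
      (simp only: eval3_sum case_prod_unfold eval3_scaled_mon3[unfolded prod.collapse])
  moreover have "c ^ n = c ^ i * (c ^ j * c ^ k)" if "(i, j, k) \<in> exps n" for i j k
    using that by (auto simp: exps_def power_add)
  ultimately show ?thesis
    by (auto simp: sum_distrib_left power_mult_distrib algebra_simps intro!: sum.cong)
qed

definition dehomogenise :: "3 \<Rightarrow> complex^3 \<Rightarrow> complex^2" where
  "dehomogenise j z =
     (if j = 1 then vector [z $ 2 / z $ 1, z $ 3 / z $ 1]
      else if j = 2 then vector [z $ 1 / z $ 2, z $ 3 / z $ 2]
      else vector [z $ 1 / z $ 3, z $ 2 / z $ 3])"

lemma affine_chart_dehomogenise: "z $ j \<noteq> 0 \<Longrightarrow> affine_chart j (dehomogenise j z) = inverse (z $ j) *s z"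
  using exhaust_3[of j]
  by (auto simp: affine_chart_def dehomogenise_def vec_eq_iff forall_3 divide_simps)

lemma dehomogenise_affine_chart: "dehomogenise j (affine_chart j x) = x"
  using exhaust_3[of j] by (auto simp: affine_chart_def dehomogenise_def vec_eq_iff forall_2)

lemma dehomogenise_scale: "c \<noteq> 0 \<Longrightarrow> dehomogenise j (c *s z) = dehomogenise j z"
  using exhaust_3[of j] by (auto simp: dehomogenise_def vec_eq_iff forall_2)

lemma holomorphic_fun_affine_chart: "open U \<Longrightarrow> holomorphic_fun U (\<lambda>x. affine_chart i x $ l)"
  using exhaust_3[of i] exhaust_3[of l]
  by (auto simp: affine_chart_def intro: holomorphic_fun_const holomorphic_fun_nth)

lemma holomorphic_map_chart_change:
  assumes "open U" "\<And>x. x \<in> U \<Longrightarrow> affine_chart i x $ j \<noteq> 0"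
  shows "holomorphic_map U (\<lambda>x. dehomogenise j (affine_chart i x))"
proof -
  have "holomorphic_fun U (\<lambda>x. affine_chart i x $ l / affine_chart i x $ j)" for l
    using assms by (intro holomorphic_fun_divide holomorphic_fun_affine_chart)
  then show ?thesis
    using exhaust_3[of j] unfolding holomorphic_map_def
    by (auto simp: dehomogenise_def forall_2)
qed

lemma holomorphic_map_continuous:
  assumes "holomorphic_map U \<phi>"
  shows "continuous_on U \<phi>"
proof (rule continuous_at_imp_continuous_on, rule ballI)
  fix x assume "x \<in> U"
  with assms obtain \<phi>' where "(\<phi> has_derivative \<phi>') (at x)" by (rule holomorphic_mapE)
  then show "isCont \<phi> x" by (rule has_derivative_continuous)
qed

lemma holomorphic_fun_continuous:
  assumes "holomorphic_fun U f"
  shows "continuous_on U f"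
proof (rule continuous_at_imp_continuous_on, rule ballI)
  fix x assume "x \<in> U"
  with assms obtain f' where "(f has_derivative f') (at x)" by (rule holomorphic_funE)
  then show "isCont f x" by (rule has_derivative_continuous)
qed

lemma open_affine_chart_nonzero: "open {x. affine_chart i x $ j \<noteq> 0}"
proof -
  have "continuous_on UNIV (\<lambda>x. affine_chart i x $ j)"
    by (intro holomorphic_fun_continuous holomorphic_fun_affine_chart) simp
  then have "open ((\<lambda>x. affine_chart i x $ j) -` (- {0}))"
    by (intro open_vimage) auto
  then show ?thesis by (simp add: vimage_def)
qed

text \<open>\<open>has_ade_type\<close> allows any chart, so two types of one point may be witnessed
  in different charts. The transition map is biholomorphic where both charts are defined, and by
  homogeneity the equation changes by the \<open>n\<close>-th power of a nonvanishing coordinate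
  quotient.\<close>

lemma analytically_equivalent_chart_change:
  assumes F: "homogeneous n F" and p: "proj_pt (affine_chart i a) = proj_pt (affine_chart j b)"
  shows "analytically_equivalent (\<lambda>x. eval3 F (affine_chart i x)) a (\<lambda>x. eval3 F (affine_chart j x)) b"
proof -
  define \<tau> where "\<tau> = (\<lambda>i j x. dehomogenise j (affine_chart i x))"
  define U where "U = (\<lambda>i j. {x. affine_chart i x $ j \<noteq> 0})"
  have chart: "affine_chart j (\<tau> i j x) = inverse (affine_chart i x $ j) *s affine_chart i x"
    if "x \<in> U i j" for i j x
    using that by (simp add: \<tau>_def U_def affine_chart_dehomogenise)
  have maps: "\<tau> i j x \<in> U j i" if "x \<in> U i j" for i j x
    using chart[OF that] that by (simp add: U_def affine_chart_nth)
  have inv: "\<tau> j i (\<tau> i j x) = x" if "x \<in> U i j" for i j x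
  proof -
    have "\<tau> j i (\<tau> i j x) = dehomogenise i (inverse (affine_chart i x $ j) *s affine_chart i x)"
      unfolding chart[OF that, symmetric] by (simp only: \<tau>_def)
    then show ?thesis using that by (simp add: U_def dehomogenise_scale dehomogenise_affine_chart)
  qed
  have hol: "holomorphic_map (U i j) (\<tau> i j)" for i j
    unfolding \<tau>_def U_def by (rule holomorphic_map_chart_change[OF open_affine_chart_nonzero]) simp
  have hom: "homeomorphism (U i j) (U j i) (\<tau> i j) (\<tau> j i)"
    using maps inv by (intro homeomorphismI holomorphic_map_continuous[OF hol]) auto
  have self: "v \<in> proj_pt v" for v
    unfolding proj_pt_def by (simp add: vec.span_base)
  have "affine_chart j b \<in> proj_pt (affine_chart i a)" "affine_chart i a \<in> proj_pt (affine_chart j b)"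
    using self[of "affine_chart j b"] self[of "affine_chart i a"] p by simp_all
  then obtain k l where k: "affine_chart j b = k *s affine_chart i a"
    and l: "affine_chart i a = l *s affine_chart j b"
    unfolding proj_pt_def vec.span_singleton by (elim imageE)
  have "k \<noteq> 0" using k affine_chart_nonzero[of j b] by auto
  have "l \<noteq> 0" using l affine_chart_nonzero[of i a] by auto
  have a: "a \<in> U i j" using l \<open>l \<noteq> 0\<close> by (simp add: U_def affine_chart_nth)
  have b: "b \<in> U j i" using k \<open>k \<noteq> 0\<close> by (simp add: U_def affine_chart_nth)
  have ab: "\<tau> i j a = b"
    unfolding \<tau>_def using l \<open>l \<noteq> 0\<close> by (simp add: dehomogenise_scale dehomogenise_affine_chart)
  have holu: "holomorphic_fun (U i j) (\<lambda>x. inverse (affine_chart i x $ j) ^ n)"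
    by (intro holomorphic_fun_power holomorphic_fun_inverse holomorphic_fun_affine_chart)
      (auto simp: U_def open_affine_chart_nonzero)
  have eq: "inverse (affine_chart i x $ j) ^ n \<noteq> 0 \<and> eval3 F (affine_chart j (\<tau> i j x)) =
      inverse (affine_chart i x $ j) ^ n * eval3 F (affine_chart i x)" if "x \<in> U i j" for x
    using chart[OF that] eval3_scale[OF F] that by (simp add: U_def)
  then have eq: "\<forall>x\<in>U i j. inverse (affine_chart i x $ j) ^ n \<noteq> 0 \<and> eval3 F (affine_chart j (\<tau> i j x)) =
      inverse (affine_chart i x $ j) ^ n * eval3 F (affine_chart i x)" by blast
  show ?thesis
    unfolding analytically_equivalent_def using a b ab hom hol[of i j] hol[of j i] holu eq
    by (intro exI[of _ "U i j"] exI[of _ "U j i"] exI[of _ "\<tau> i j"] exI[of _ "\<tau> j i"]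
        exI[of _ "\<lambda>x. inverse (affine_chart i x $ j) ^ n"] conjI)
qed

section \<open>Quadratic parts and the uniqueness of the types A1 and A2\<close>

lemma has_derivative_line: "((\<lambda>t::complex. a + t *s w) has_derivative (\<lambda>h. h *s (w :: complex^'n))) (at t)"
  by (rule has_derivative_vec) (auto intro!: derivative_eq_intros)

lemma directional_limit:
  assumes \<phi>: "(\<phi> has_derivative \<phi>') (at a)" "\<And>c v. \<phi>' (c *s v) = c *s \<phi>' v" "\<phi> a = 0"
  shows "((\<lambda>t. \<phi> (a + t *s w) $ i / t) \<longlongrightarrow> \<phi>' w $ i) (at (0::complex))"
proof -
  have "((\<lambda>t. \<phi> (a + t *s w)) has_derivative (\<lambda>h. \<phi>' (h *s w))) (at 0)"
    by (rule has_derivative_compose[OF has_derivative_line]) (simp add: \<phi>(1))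
  then have "((\<lambda>t. \<phi> (a + t *s w) $ i) has_derivative (\<lambda>h. \<phi>' (h *s w) $ i)) (at 0)"
    by (rule bounded_linear.has_derivative[OF bounded_linear_vec_nth])
  then have "((\<lambda>t. \<phi> (a + t *s w) $ i) has_field_derivative (\<phi>' w $ i)) (at 0)"
    by (simp add: has_field_derivative_def \<phi>(2) mult_commute_abs mult.commute)
  then show ?thesis by (simp add: has_field_derivative_iff \<phi>(3))
qed

text \<open>For valid types, the quadratic part of the normal form: rank 2 for A1, rank 1 for every
  other \<open>A k\<close>, and zero for D and E.\<close>

definition ade_quadratic :: "ade \<Rightarrow> complex^2 \<Rightarrow> complex" where
  "ade_quadratic T v = (if T = A 1 then (v $ 1)^2 + (v $ 2)^2 else if T \<in> range A then (v $ 1)^2 else 0)"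

text \<open>With \<open>X\<close> and \<open>Y\<close> the convergent quotients of the coordinates
  by \<open>t\<close>, every monomial of degree above 2, divided by \<open>t^2\<close>, retains a
  factor that tends to 0.\<close>

lemma ade_equation_limit:
  assumes T: "valid_ade T"
    and x: "((\<lambda>t. z t $ 1 / t) \<longlongrightarrow> p $ 1) (at (0::complex))" and y: "((\<lambda>t. z t $ 2 / t) \<longlongrightarrow> p $ 2) (at 0)"
  shows "((\<lambda>t. ade_equation T (z t) / t^2) \<longlongrightarrow> ade_quadratic T p) (at 0)"
proof -
  define X where "X = (\<lambda>t. z t $ 1 / t)"
  define Y where "Y = (\<lambda>t. z t $ 2 / t)"
  have X: "(X \<longlongrightarrow> p $ 1) (at 0)" and Y: "(Y \<longlongrightarrow> p $ 2) (at 0)"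
    using x y by (simp_all add: X_def Y_def)
  have zXY: "z t $ 1 = X t * t" "z t $ 2 = Y t * t" if "t \<noteq> 0" for t
    using that by (simp_all add: X_def Y_def)
  have X0: "((\<lambda>t. X t * t) \<longlongrightarrow> 0) (at 0)" and Y0: "((\<lambda>t. Y t * t) \<longlongrightarrow> 0) (at 0)"
    using tendsto_mult[OF X tendsto_ident_at] tendsto_mult[OF Y tendsto_ident_at] by simp_all
  have Yp: "((\<lambda>t. (Y t * t) ^ Suc m) \<longlongrightarrow> 0) (at 0)" for m
    using tendsto_power[OF Y0, of "Suc m"] by simp
  have lim: ?thesis if "(g \<longlongrightarrow> ade_quadratic T p) (at 0)"
    "\<And>t. t \<noteq> 0 \<Longrightarrow> ade_equation T (z t) = g t * t^2" for g
  proof (rule Lim_transform_eventually[OF that(1)])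
    show "\<forall>\<^sub>F t in at 0. g t = ade_equation T (z t) / t^2"
      using that(2) by (auto simp: eventually_at_filter)
  qed
  show ?thesis
  proof (cases T)
    case (A k)
    show ?thesis
    proof (cases "k = 1")
      case True
      show ?thesis
        by (rule lim[of "\<lambda>t. X t ^ 2 + Y t ^ 2"])
          (auto simp: A True ade_quadratic_def zXY algebra_simps power2_eq_square intro!: tendsto_intros X Y)
    next
      case False
      then obtain m where k: "k = Suc (Suc m)" using T A by (cases k; cases "k - 1") auto
      have "((\<lambda>t. X t ^ 2 + Y t ^ 2 * (Y t * t) ^ Suc m) \<longlongrightarrow> (p $ 1)^2 + (p $ 2)^2 * 0) (at 0)"
        by (intro tendsto_intros X Y Yp)
      then show ?thesis
        by (intro lim[of "\<lambda>t. X t ^ 2 + Y t ^ 2 * (Y t * t) ^ Suc m"])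
          (auto simp: A k ade_quadratic_def zXY algebra_simps power2_eq_square)
    qed
  next
    case (D k)
    then obtain m where k: "k = m + 4" using T by (metis le_add_diff_inverse2 valid_ade.simps(2))
    have "((\<lambda>t. X t ^ 2 * (Y t * t) + Y t ^ 2 * (Y t * t) ^ Suc m) \<longlongrightarrow> (p $ 1)^2 * 0 + (p $ 2)^2 * 0) (at 0)"
      by (intro tendsto_intros X Y Y0 Yp)
    moreover have "k - 1 = Suc (Suc (Suc m))" using k by simp
    ultimately show ?thesis
      by (intro lim[of "\<lambda>t. X t ^ 2 * (Y t * t) + Y t ^ 2 * (Y t * t) ^ Suc m"])
        (auto simp: D ade_quadratic_def zXY algebra_simps power2_eq_square)
  next
    case E6
    have "((\<lambda>t. X t ^ 2 * (X t * t) + Y t ^ 2 * (Y t * t) ^ Suc 1) \<longlongrightarrow> (p $ 1)^2 * 0 + (p $ 2)^2 * 0) (at 0)"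
      by (intro tendsto_intros X Y X0 Yp)
    then show ?thesis
      by (intro lim[of "\<lambda>t. X t ^ 2 * (X t * t) + Y t ^ 2 * (Y t * t) ^ Suc 1"])
        (auto simp: E6 ade_quadratic_def zXY algebra_simps eval_nat_numeral)
  next
    case E7
    have "((\<lambda>t. X t ^ 2 * (X t * t) + X t * Y t * (Y t * t) ^ Suc 1) \<longlongrightarrow> (p $ 1)^2 * 0 + p $ 1 * p $ 2 * 0) (at 0)"
      by (intro tendsto_intros X Y X0 Yp)
    then show ?thesis
      by (intro lim[of "\<lambda>t. X t ^ 2 * (X t * t) + X t * Y t * (Y t * t) ^ Suc 1"])
        (auto simp: E7 ade_quadratic_def zXY algebra_simps eval_nat_numeral)
  next
    case E8
    have "((\<lambda>t. X t ^ 2 * (X t * t) + Y t ^ 2 * (Y t * t) ^ Suc 2) \<longlongrightarrow> (p $ 1)^2 * 0 + (p $ 2)^2 * 0) (at 0)"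
      by (intro tendsto_intros X Y X0 Yp)
    then show ?thesis
      by (intro lim[of "\<lambda>t. X t ^ 2 * (X t * t) + Y t ^ 2 * (Y t * t) ^ Suc 2"])
        (auto simp: E8 ade_quadratic_def zXY algebra_simps eval_nat_numeral)
  qed
qed

lemma holomorphic_map_derivative:
  assumes "holomorphic_map U \<phi>" "x \<in> U"
  shows "\<exists>\<phi>'. (\<phi> has_derivative \<phi>') (at x) \<and> (\<forall>c v. \<phi>' (c *s v) = c *s \<phi>' v)"
  using holomorphic_mapE[OF assms] by metis

text \<open>Differentiating both identities between \<open>\<phi>\<close> and its inverse
  \<open>\<psi>\<close> shows that their derivatives are inverse to each other.\<close>

lemma analytically_equivalent_derivative:
  assumes "a \<in> U" "b \<in> V" "\<phi> a = b" "homeomorphism U V \<phi> \<psi>" "holomorphic_map U \<phi>" "holomorphic_map V \<psi>"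
  shows "\<exists>\<phi>'. (\<phi> has_derivative \<phi>') (at a) \<and> (\<forall>c v. \<phi>' (c *s v) = c *s \<phi>' v) \<and> bij \<phi>'"
proof -
  from holomorphic_map_derivative[OF assms(5,1)] obtain \<phi>' where
    "(\<phi> has_derivative \<phi>') (at a) \<and> (\<forall>c v. \<phi>' (c *s v) = c *s \<phi>' v)" ..
  then have \<phi>': "(\<phi> has_derivative \<phi>') (at a)" "\<And>c v. \<phi>' (c *s v) = c *s \<phi>' v" by simp_all
  from holomorphic_map_derivative[OF assms(6,2)] obtain \<psi>' where
    "(\<psi> has_derivative \<psi>') (at b) \<and> (\<forall>c v. \<psi>' (c *s v) = c *s \<psi>' v)" ..
  then have \<psi>': "(\<psi> has_derivative \<psi>') (at b)" by simp
  have inv: "\<psi> b = a" "\<And>x. x \<in> U \<Longrightarrow> \<psi> (\<phi> x) = x" "\<And>y. y \<in> V \<Longrightarrow> \<phi> (\<psi> y) = y"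
    using assms by (auto simp: homeomorphism_def)
  have "((\<lambda>x. \<psi> (\<phi> x)) has_derivative (\<lambda>h. \<psi>' (\<phi>' h))) (at a)"
    using has_derivative_compose[OF \<phi>'(1), of \<psi> \<psi>'] \<psi>' by (simp only: assms(3))
  moreover have "((\<lambda>x. \<psi> (\<phi> x)) has_derivative (\<lambda>h. h)) (at a)"
    by (rule has_derivative_transform_within_open[OF has_derivative_ident holomorphic_map_open[OF assms(5)] assms(1)])
      (simp only: inv(2))
  ultimately have 1: "(\<lambda>h. \<psi>' (\<phi>' h)) = (\<lambda>h. h)" by (rule has_derivative_unique)
  have "((\<lambda>y. \<phi> (\<psi> y)) has_derivative (\<lambda>h. \<phi>' (\<psi>' h))) (at b)"
    using has_derivative_compose[OF \<psi>', of \<phi> \<phi>'] \<phi>'(1) by (simp only: inv(1))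
  moreover have "((\<lambda>y. \<phi> (\<psi> y)) has_derivative (\<lambda>h. h)) (at b)"
    by (rule has_derivative_transform_within_open[OF has_derivative_ident holomorphic_map_open[OF assms(6)] assms(2)])
      (simp only: inv(3))
  ultimately have 2: "(\<lambda>h. \<phi>' (\<psi>' h)) = (\<lambda>h. h)" by (rule has_derivative_unique)
  have "bij \<phi>'"
    by (rule o_bij[of \<psi>']) (use 1 2 in \<open>auto simp: fun_eq_iff\<close>)
  with \<phi>' show ?thesis by (intro exI[of _ \<phi>']) simp
qed

text \<open>A first derivative of the coordinate change is enough: along a complex line
  \<open>\<phi>\<close> equals \<open>t *s L w\<close> up to higher order, and the unit tends to its
  value at \<open>a\<close>. So the quadratic part is an invariant up to a linear change of
  coordinates and a constant.\<close>

lemma quadratic_limit: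
  assumes "analytically_equivalent f a (ade_equation T) 0" and T: "valid_ade T"
  shows "\<exists>c L. c \<noteq> 0 \<and> linear L \<and> (\<forall>c v. L (c *s v) = c *s L v) \<and> bij L \<and>
    (\<forall>w. ((\<lambda>t. f (a + t *s w) / t^2) \<longlongrightarrow> c * ade_quadratic T (L w)) (at (0::complex)))"
proof -
  obtain U V \<phi> \<psi> u where *: "a \<in> U" "0 \<in> V" "\<phi> a = 0" "homeomorphism U V \<phi> \<psi>"
    "holomorphic_map U \<phi>" "holomorphic_map V \<psi>" "holomorphic_fun U u"
    "\<And>x. x \<in> U \<Longrightarrow> u x \<noteq> 0 \<and> ade_equation T (\<phi> x) = u x * f x"
    using assms(1) unfolding analytically_equivalent_def by blast
  from analytically_equivalent_derivative[OF *(1-6)] obtain L where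
    "(\<phi> has_derivative L) (at a) \<and> (\<forall>c v. L (c *s v) = c *s L v) \<and> bij L" ..
  then have L: "(\<phi> has_derivative L) (at a)" "\<And>c v. L (c *s v) = c *s L v" "bij L" by simp_all
  show ?thesis
  proof (intro exI conjI allI)
    show "inverse (u a) \<noteq> 0" using *(1,8) by simp
    show "linear L" using L(1) has_derivative_linear by blast
    show "L (c *s v) = c *s L v" for c v by (rule L)
    show "bij L" by (rule L)
    fix w
    show "((\<lambda>t. f (a + t *s w) / t^2) \<longlongrightarrow> inverse (u a) * ade_quadratic T (L w)) (at 0)"
    proof -
    have line: "((\<lambda>t::complex. a + t *s w) \<longlongrightarrow> a) (at 0)"
      using has_derivative_continuous[OF has_derivative_line[of a w 0]] by (simp add: isCont_def)
    have "isCont u a"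
      using *(7,1) holomorphic_fun_continuous holomorphic_fun_open continuous_on_eq_continuous_at by blast
    then have "((\<lambda>t. u (a + t *s w)) \<longlongrightarrow> u a) (at 0)"
      using line by (rule isCont_tendsto_compose)
    moreover have "((\<lambda>t. ade_equation T (\<phi> (a + t *s w)) / t^2) \<longlongrightarrow> ade_quadratic T (L w)) (at 0)"
      by (intro ade_equation_limit T directional_limit L *(3))
    ultimately have "((\<lambda>t. inverse (u (a + t *s w)) * (ade_equation T (\<phi> (a + t *s w)) / t^2)) \<longlongrightarrow>
        inverse (u a) * ade_quadratic T (L w)) (at 0)"
      using *(1,8) by (intro tendsto_intros) auto
    moreover have "\<forall>\<^sub>F t in at 0. inverse (u (a + t *s w)) * (ade_equation T (\<phi> (a + t *s w)) / t^2)
        = f (a + t *s w) / t^2"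
      using topological_tendstoD[OF line holomorphic_map_open[OF *(5)] *(1)]
      by (rule eventually_mono) (use *(8) in \<open>auto simp: field_simps\<close>)
    ultimately show ?thesis
      by (rule Lim_transform_eventually)
    qed
  qed
qed

lemma ade_equation_line_limit:
  assumes "valid_ade T"
  shows "((\<lambda>t::complex. ade_equation T (t *s w) / t^2) \<longlongrightarrow> ade_quadratic T w) (at 0)"
proof (rule ade_equation_limit[OF assms])
  have "((\<lambda>t. (t *s w) $ i / t) \<longlongrightarrow> w $ i) (at 0)" for i
    by (rule Lim_transform_eventually[OF tendsto_const]) (auto simp: eventually_at_filter)
  then show "((\<lambda>t. (t *s w) $ 1 / t) \<longlongrightarrow> w $ 1) (at 0)" "((\<lambda>t. (t *s w) $ 2 / t) \<longlongrightarrow> w $ 2) (at 0)"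
    by blast+
qed

text \<open>The zeros of a quadratic form of rank at most 1 form a subspace, whereas the isotropic
  vectors \<open>(1, i)\<close> and \<open>(1, -i)\<close> of \<open>x^2 + y^2\<close> have a sum
  that is not isotropic.\<close>

lemma A1_unique:
  assumes "analytically_equivalent (ade_equation T) 0 (ade_equation (A 1)) 0" and T: "valid_ade T"
  shows "T = A 1"
proof (rule ccontr)
  assume "T \<noteq> A 1"
  have "valid_ade (A 1)" by simp
  from quadratic_limit[OF assms(1) this] obtain c L where
    "c \<noteq> 0 \<and> linear L \<and> (\<forall>c v. L (c *s v) = c *s L v) \<and> bij L \<and> (\<forall>w.
      ((\<lambda>t. ade_equation T (0 + t *s w) / t^2) \<longlongrightarrow> c * ade_quadratic (A 1) (L w)) (at (0::complex)))"
    by (elim exE)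
  then have L: "c \<noteq> 0" "linear L" "bij L"
    "\<And>w. ((\<lambda>t. ade_equation T (0 + t *s w) / t^2) \<longlongrightarrow> c * ade_quadratic (A 1) (L w)) (at (0::complex))"
    by simp_all
  have q: "ade_quadratic T w = c * ((L w $ 1)^2 + (L w $ 2)^2)" for w
    using tendsto_unique[OF _ ade_equation_line_limit[OF T, of w] L(4)[of w, simplified]]
    by (simp add: ade_quadratic_def)
  obtain v w where v: "L v = vector [1, \<i>]" and w: "L w = vector [1, - \<i>]"
    using L(3) by (metis bij_pointE)
  have vw: "L (v + w) = vector [2, 0]"
    unfolding linear_add[OF L(2)] v w by (simp add: vec_eq_iff forall_2)
  have "ade_quadratic T v = 0" "ade_quadratic T w = 0" "ade_quadratic T (v + w) \<noteq> 0"
    unfolding q v w vw using L(1) by simp_all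
  then show False
    using \<open>T \<noteq> A 1\<close> by (auto simp: ade_quadratic_def split: if_splits)
qed

text \<open>The difference quotient at 0 extends holomorphically across 0 and vanishes there, so it
  can be divided by \<open>t\<close> once more.\<close>

lemma holomorphic_double_zero:
  assumes f: "f holomorphic_on S" and S: "open S" "0 \<in> S" and f0: "f 0 = 0"
    and lim: "((\<lambda>t. f t / t) \<longlongrightarrow> 0) (at 0)"
  obtains l where "((\<lambda>t. f t / t^2) \<longlongrightarrow> l) (at 0)"
proof -
  have d: "deriv f 0 = 0"
  proof (rule DERIV_imp_deriv)
    show "(f has_field_derivative 0) (at 0)"
      using lim f0 by (simp add: has_field_derivative_iff)
  qed
  define g where "g = (\<lambda>z. if z = 0 then deriv f 0 else (f z - f 0) / (z - 0))"
  have "g holomorphic_on S"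
    unfolding g_def using S by (intro pole_lemma[OF f]) (simp add: interior_open)
  then obtain g' where "(g has_field_derivative g') (at 0)"
    using S holomorphic_on_imp_differentiable_at field_differentiable_def by blast
  then have "((\<lambda>t. g t / t) \<longlongrightarrow> g') (at 0)"
    by (simp add: has_field_derivative_iff g_def d)
  moreover have "\<forall>\<^sub>F t in at 0. g t / t = f t / t^2"
    by (auto simp: eventually_at_filter g_def f0 power2_eq_square)
  ultimately have "((\<lambda>t. f t / t^2) \<longlongrightarrow> g') (at 0)"
    by (rule Lim_transform_eventually)
  then show thesis by (rule that)
qed

text \<open>The quadratic part cannot separate A2 from \<open>A k\<close> with \<open>k > 2\<close>,
  so third-order contact has to be compared.\<close>

lemma A2_unique:
  assumes "analytically_equivalent (ade_equation T) 0 (ade_equation (A 2)) 0" and T: "valid_ade T"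
    and T1: "T \<noteq> A 1"
  shows "T = A 2"
proof (rule ccontr)
  assume T2: "T \<noteq> A 2"
  obtain U V \<phi> \<psi> u where *: "0 \<in> U" "0 \<in> V" "\<phi> 0 = 0" "homeomorphism U V \<phi> \<psi>"
    "holomorphic_map U \<phi>" "holomorphic_map V \<psi>" "holomorphic_fun U u"
    "\<And>x. x \<in> U \<Longrightarrow> u x \<noteq> 0 \<and> ade_equation (A 2) (\<phi> x) = u x * ade_equation T x"
    using assms(1) unfolding analytically_equivalent_def by blast
  from analytically_equivalent_derivative[OF *(1-6)] obtain L where
    "(\<phi> has_derivative L) (at 0) \<and> (\<forall>c v. L (c *s v) = c *s L v) \<and> bij L" ..
  then have L: "(\<phi> has_derivative L) (at 0)" "\<And>c v. L (c *s v) = c *s L v" "bij L" by simp_all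
  \<comment> \<open>For the other types a coordinate axis meets the normal form with multiplicity at least 4, but no
    smooth arc has this order of contact with a cusp.\<close>
  obtain w :: "complex^2" where w: "w \<noteq> 0" "((\<lambda>t. ade_equation T (t *s w) / t^3) \<longlongrightarrow> 0) (at (0::complex))"
  proof -
    have pow: "((\<lambda>t::complex. t ^ m / t^3) \<longlongrightarrow> 0) (at 0)" if "m \<ge> 4" for m
    proof -
      define r where "r = m - 4"
      have m: "m = Suc r + 3" using that by (simp add: r_def)
      have "((\<lambda>t::complex. t ^ Suc r) \<longlongrightarrow> 0 ^ Suc r) (at 0)" by (intro tendsto_intros)
      then have "((\<lambda>t::complex. t ^ Suc r) \<longlongrightarrow> 0) (at 0)" by simp
      moreover have "t ^ Suc r = t ^ m / t ^ 3" if "t \<noteq> 0" for t :: complex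
        unfolding m power_add using that by simp
      then have "\<forall>\<^sub>F t :: complex in at 0. t ^ Suc r = t ^ m / t ^ 3"
        unfolding eventually_at_filter by (intro always_eventually) blast
      ultimately show ?thesis by (rule Lim_transform_eventually)
    qed
    show thesis
    proof (cases T)
      case (A k)
      with T T1 T2 have "k + 1 \<ge> 4" by (cases "k \<in> {0, 1, 2}") auto
      show thesis
        by (rule that[of "vector [0, 1]"]) (use pow[OF \<open>k + 1 \<ge> 4\<close>] in \<open>auto simp: A vec_eq_iff forall_2\<close>)
    next
      case (D k)
      with T show thesis
        by (intro that[of "vector [1, 0]"]) (auto simp: vec_eq_iff forall_2 power_0_left)
    next
      case E6
      show thesis
        by (rule that[of "vector [0, 1]"]) (use pow[of 4] in \<open>auto simp: E6 vec_eq_iff forall_2\<close>)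
    next
      case E7
      show thesis
        by (rule that[of "vector [0, 1]"]) (auto simp: E7 vec_eq_iff forall_2)
    next
      case E8
      show thesis
        by (rule that[of "vector [0, 1]"]) (use pow[of 5] in \<open>auto simp: E8 vec_eq_iff forall_2\<close>)
    qed
  qed
  define x where "x = (\<lambda>t. \<phi> (t *s w) $ 1)"
  define y where "y = (\<lambda>t. \<phi> (t *s w) $ 2)"
  have x1: "((\<lambda>t. x t / t) \<longlongrightarrow> L w $ 1) (at 0)" and y1: "((\<lambda>t. y t / t) \<longlongrightarrow> L w $ 2) (at 0)"
    using directional_limit[OF L(1,2) *(3), of w] by (simp_all add: x_def y_def)
  have line: "((\<lambda>t::complex. t *s w) \<longlongrightarrow> 0) (at 0)"
    using has_derivative_continuous[OF has_derivative_line[of 0 w 0]] by (simp add: isCont_def)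
  have "isCont u 0"
    using *(7,1) holomorphic_fun_continuous holomorphic_fun_open continuous_on_eq_continuous_at by blast
  then have "((\<lambda>t. u (t *s w)) \<longlongrightarrow> u 0) (at 0)"
    using line by (rule isCont_tendsto_compose)
  then have "((\<lambda>t. u (t *s w) * (ade_equation T (t *s w) / t^3)) \<longlongrightarrow> u 0 * 0) (at 0)"
    using w(2) by (intro tendsto_intros)
  moreover have "\<forall>\<^sub>F t in at 0. u (t *s w) * (ade_equation T (t *s w) / t^3) = (x t ^ 2 + y t ^ 3) / t^3"
    using topological_tendstoD[OF line holomorphic_map_open[OF *(5)] *(1)]
    by (rule eventually_mono) (use *(8) in \<open>auto simp: x_def y_def\<close>)
  ultimately have "((\<lambda>t. (x t ^ 2 + y t ^ 3) / t^3) \<longlongrightarrow> u 0 * 0) (at 0)"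
    by (rule Lim_transform_eventually)
  then have sum3: "((\<lambda>t. (x t ^ 2 + y t ^ 3) / t^3) \<longlongrightarrow> 0) (at 0)" by (simp only: mult_zero_right)
  \<comment> \<open>The same quotient multiplied by \<open>t\<close> isolates the quadratic term:
    the arc must be tangent to the cusp, that is, the first coordinate of \<open>L w\<close>
    vanishes.\<close>
  have "((\<lambda>t. (x t / t)^2 + (y t / t)^3 * t) \<longlongrightarrow> (L w $ 1)^2 + (L w $ 2)^3 * 0) (at 0)"
    by (intro tendsto_intros x1 y1)
  moreover have "\<forall>\<^sub>F t in at 0. (x t / t)^2 + (y t / t)^3 * t = (x t ^ 2 + y t ^ 3) / t^3 * t"
    by (auto simp: eventually_at_filter field_simps eval_nat_numeral)
  ultimately have "((\<lambda>t. (x t ^ 2 + y t ^ 3) / t^3 * t) \<longlongrightarrow> (L w $ 1)^2 + (L w $ 2)^3 * 0) (at 0)"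
    by (rule Lim_transform_eventually)
  moreover have "((\<lambda>t. (x t ^ 2 + y t ^ 3) / t^3 * t) \<longlongrightarrow> 0 * 0) (at 0)"
    by (intro tendsto_intros sum3)
  ultimately have "(L w $ 1)^2 + (L w $ 2)^3 * 0 = 0 * 0"
    by (rule tendsto_unique[OF at_neq_bot])
  then have Lw1: "L w $ 1 = 0" by simp
  define S where "S = {t::complex. t *s w \<in> U}"
  have "continuous_on UNIV (\<lambda>t::complex. t *s w)"
    using has_derivative_continuous[OF has_derivative_line[of 0 w]] by (simp add: continuous_on_eq_continuous_at)
  then have "open ((\<lambda>t::complex. t *s w) -` U)"
    using holomorphic_map_open[OF *(5)] by (intro open_vimage)
  then have S: "open S" "0 \<in> S" using *(1) by (simp_all add: S_def vimage_def)
  have "x holomorphic_on S"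
    unfolding holomorphic_on_open[OF S(1)]
  proof
    fix t assume "t \<in> S"
    then have "t *s w \<in> U" by (simp add: S_def)
    from holomorphic_map_derivative[OF *(5) this] obtain M where
      "(\<phi> has_derivative M) (at (t *s w)) \<and> (\<forall>c v. M (c *s v) = c *s M v)" ..
    then have M: "(\<phi> has_derivative M) (at (t *s w))" "\<And>c v. M (c *s v) = c *s M v" by simp_all
    have "((\<lambda>t. \<phi> (0 + t *s w)) has_derivative (\<lambda>h. M (h *s w))) (at t)"
      by (rule has_derivative_compose[OF has_derivative_line]) (simp add: M(1))
    then have "((\<lambda>t. \<phi> (t *s w) $ 1) has_derivative (\<lambda>h. M (h *s w) $ 1)) (at t)"
      by (intro bounded_linear.has_derivative[OF bounded_linear_vec_nth]) simp
    then have "(x has_field_derivative (M w $ 1)) (at t)"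
      by (simp add: has_field_derivative_def M(2) mult_commute_abs mult.commute x_def)
    then show "\<exists>x'. (x has_field_derivative x') (at t)" by blast
  qed
  \<comment> \<open>Now \<open>x t\<close> has a double zero, so its square contributes order at
    least 4. Hence \<open>y t / t\<close> must tend to 0 as well, and \<open>L w = 0\<close>
    contradicts injectivity.\<close>
  then obtain l where l: "((\<lambda>t. x t / t^2) \<longlongrightarrow> l) (at 0)"
    using holomorphic_double_zero[OF _ S, of x] x1 *(3) Lw1 by (auto simp: x_def)
  have "((\<lambda>t. (x t ^ 2 + y t ^ 3) / t^3 - (x t / t^2)^2 * t) \<longlongrightarrow> 0 - l^2 * 0) (at 0)"
    by (intro tendsto_intros sum3 l)
  moreover have "\<forall>\<^sub>F t in at 0. (x t ^ 2 + y t ^ 3) / t^3 - (x t / t^2)^2 * t = (y t / t)^3"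
    by (auto simp: eventually_at_filter field_simps eval_nat_numeral)
  ultimately have "((\<lambda>t. (y t / t)^3) \<longlongrightarrow> 0 - l^2 * 0) (at 0)"
    by (rule Lim_transform_eventually)
  moreover have "((\<lambda>t. (y t / t)^3) \<longlongrightarrow> (L w $ 2)^3) (at 0)"
    by (intro tendsto_intros y1)
  ultimately have "0 - l^2 * 0 = (L w $ 2)^3"
    by (rule tendsto_unique[OF at_neq_bot])
  with Lw1 have "L w = 0" by (simp add: vec_eq_iff forall_2)
  moreover have "L 0 = 0" using L(2)[of 0 0] by simp
  ultimately have "L w = L 0" by simp
  then show False using injD[OF bij_is_inj[OF L(3)]] w(1) by simp
qed

text \<open>This evaluates \<open>THE\<close> in \<open>MK_number_at\<close> at nodes and cusps.
  Composing the two equivalences with a chart change compares the normal forms directly.\<close>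

lemma has_ade_type_unique:
  assumes F: "homogeneous n F" and k: "k \<in> {1, 2}"
    and 1: "has_ade_type F p (A k)" and 2: "has_ade_type F p T"
  shows "T = A k"
proof -
  obtain i a where a: "p = proj_pt (affine_chart i a)"
    "analytically_equivalent (\<lambda>x. eval3 F (affine_chart i x)) a (ade_equation (A k)) 0"
    using 1 unfolding has_ade_type_def by blast
  obtain j b where b: "p = proj_pt (affine_chart j b)" "valid_ade T"
    "analytically_equivalent (\<lambda>x. eval3 F (affine_chart j x)) b (ade_equation T) 0"
    using 2 unfolding has_ade_type_def by blast
  have "analytically_equivalent (\<lambda>x. eval3 F (affine_chart j x)) b (\<lambda>x. eval3 F (affine_chart i x)) a"
    using analytically_equivalent_chart_change[OF F] a(1) b(1) by simp
  then have eq: "analytically_equivalent (ade_equation T) 0 (ade_equation (A k)) 0"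
    using analytically_equivalent_trans[OF analytically_equivalent_trans[OF
        analytically_equivalent_sym[OF b(3)]] a(2)] by simp
  show ?thesis
  proof (cases "k = 1")
    case True
    with eq b(2) A1_unique show ?thesis by simp
  next
    case False
    then have k2: "k = 2" using k by simp
    \<comment> \<open>The criterion for nodes is applied with the roles exchanged, where it would
      force \<open>A k = A 1\<close>.\<close>
    have "T \<noteq> A 1"
    proof
      assume "T = A 1"
      then have "A k = A 1"
        using analytically_equivalent_sym[OF eq] k2 by (intro A1_unique) auto
      with k2 show False by simp
    qed
    with eq b(2) A2_unique k2 show ?thesis by simp
  qed
qed

section \<open>Singular points and their contributions\<close>

text \<open>Multiplying the limit by \<open>t^2\<close>, by \<open>t\<close> and by 1 determines one
  coefficient at a time.\<close>

lemma quadratic_remainder_limit: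
  fixes a b c q k :: complex
  assumes K: "(K \<longlongrightarrow> k) (at 0)"
    and lim: "((\<lambda>t. (a + b * t + c * t^2 + t^3 * K t) / t^2) \<longlongrightarrow> q) (at 0)"
  shows "a = 0 \<and> b = 0 \<and> c = q"
proof -
  have mult: "((\<lambda>t. (a + b * t + c * t^2 + t^3 * K t) / t^2 * h t) \<longlongrightarrow> q * h 0) (at 0)"
    if "h \<midarrow>0\<rightarrow> h 0" for h
    using that by (intro tendsto_mult lim)
  have "((\<lambda>t. a + b * t + c * t^2 + t^3 * K t) \<longlongrightarrow> a + b * 0 + c * 0^2 + 0^3 * k) (at 0)"
    by (intro tendsto_intros K)
  moreover have "((\<lambda>t. a + b * t + c * t^2 + t^3 * K t) \<longlongrightarrow> q * 0^2) (at 0)"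
    by (rule Lim_transform_eventually[OF mult[of "\<lambda>t. t^2"]])
      (auto simp: eventually_at_filter intro!: tendsto_eq_intros)
  ultimately have "a + b * 0 + c * 0^2 + 0^3 * k = q * 0^2"
    by (rule tendsto_unique[OF at_neq_bot])
  then have a: "a = 0" by simp
  have "((\<lambda>t. b + c * t + t^2 * K t) \<longlongrightarrow> b + c * 0 + 0^2 * k) (at 0)"
    by (intro tendsto_intros K)
  moreover have "((\<lambda>t. b + c * t + t^2 * K t) \<longlongrightarrow> q * 0) (at 0)"
    by (rule Lim_transform_eventually[OF mult[of "\<lambda>t. t"]])
      (auto simp: eventually_at_filter a field_simps eval_nat_numeral)
  ultimately have "b + c * 0 + 0^2 * k = q * 0"
    by (rule tendsto_unique[OF at_neq_bot])
  then have b: "b = 0" by simp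
  have "((\<lambda>t. c + t * K t) \<longlongrightarrow> c + 0 * k) (at 0)"
    by (intro tendsto_intros K)
  moreover have "((\<lambda>t. c + t * K t) \<longlongrightarrow> q) (at 0)"
    by (rule Lim_transform_eventually[OF lim])
      (auto simp: eventually_at_filter a b field_simps eval_nat_numeral)
  ultimately have "c + 0 * k = q"
    by (rule tendsto_unique[OF at_neq_bot])
  with a b show ?thesis by simp
qed

lemma continuous_poly2_line: "isCont (\<lambda>t. poly (poly r [:t * x:]) (t * y)) (t :: complex)"
  by (induction r) (auto intro!: continuous_intros)

lemma quadratic_jet:
  assumes "((\<lambda>t. poly (poly f [:t * x:]) (t * y) / t^2) \<longlongrightarrow> q) (at (0::complex))"
  shows "coeff2 f 0 0 = 0 \<and> coeff2 f 1 0 * x + coeff2 f 0 1 * y = 0 \<and>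
    coeff2 f 2 0 * x^2 + coeff2 f 1 1 * x * y + coeff2 f 0 2 * y^2 = q"
proof -
  obtain c0 c1 c2 r where f: "f = pCons c0 (pCons c1 (pCons c2 r))"
    by (metis pCons_cases)
  obtain f00 f01 f02 r0 where c0: "c0 = pCons f00 (pCons f01 (pCons f02 r0))"
    by (metis pCons_cases)
  obtain f10 f11 r1 where c1: "c1 = pCons f10 (pCons f11 r1)"
    by (metis pCons_cases)
  obtain f20 r2 where c2: "c2 = pCons f20 r2"
    by (metis pCons_cases)
  \<comment> \<open>After the six coefficients of degree at most 2 are split off, \<open>K\<close>
    collects all remaining terms divided by \<open>t^3\<close>; it is continuous at 0.\<close>
  define K where "K = (\<lambda>t. y^3 * poly r0 (t * y) + x * y^2 * poly r1 (t * y) + x^2 * y * poly r2 (t * y)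
    + x^3 * poly (poly r [:t * x:]) (t * y))"
  have "isCont K 0"
    unfolding K_def by (intro continuous_intros continuous_poly2_line)
  then have "(K \<longlongrightarrow> K 0) (at 0)" by (simp add: isCont_def)
  moreover have "poly (poly f [:t * x:]) (t * y) = f00 + (f10 * x + f01 * y) * t
      + (f20 * x^2 + f11 * x * y + f02 * y^2) * t^2 + t^3 * K t" for t
    by (simp add: f c0 c1 c2 K_def algebra_simps eval_nat_numeral)
  ultimately have "f00 = 0 \<and> f10 * x + f01 * y = 0 \<and> f20 * x^2 + f11 * x * y + f02 * y^2 = q"
    using assms by (intro quadratic_remainder_limit) simp_all
  then show ?thesis by (simp add: f c0 c1 c2 eval_nat_numeral)
qed

text \<open>Restriction to lines through \<open>a\<close> translates the analytic limits into
  coefficients: the two axis directions kill the linear part, and all directions together describe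
  the quadratic form.\<close>

lemma ade_jet:
  assumes "analytically_equivalent (\<lambda>x. eval3 F (affine_chart i x)) a (ade_equation T) 0" "valid_ade T"
  shows "vanishes 2 (loc i a F) \<and> (\<exists>c (L :: complex^2 \<Rightarrow> complex^2). c \<noteq> 0 \<and> linear L \<and> (\<forall>c v. L (c *s v) = c *s L v) \<and> bij L \<and>
    (\<forall>w. coeff2 (loc i a F) 2 0 * (w $ 1)^2 + coeff2 (loc i a F) 1 1 * w $ 1 * w $ 2 +
      coeff2 (loc i a F) 0 2 * (w $ 2)^2 = c * ade_quadratic T (L w)))"
proof -
  let ?f = "loc i a F"
  from quadratic_limit[OF assms] obtain c L where
    "c \<noteq> 0 \<and> linear L \<and> (\<forall>c v. L (c *s v) = c *s L v) \<and> bij L \<and> (\<forall>w.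
      ((\<lambda>t. eval3 F (affine_chart i (a + t *s w)) / t^2) \<longlongrightarrow> c * ade_quadratic T (L w)) (at (0::complex)))"
    by (elim exE)
  then have L: "c \<noteq> 0" "linear L" "\<forall>c v. L (c *s v) = c *s L v" "bij L" and
    lim: "\<And>w. ((\<lambda>t. eval3 F (affine_chart i (a + t *s w)) / t^2) \<longlongrightarrow> c * ade_quadratic T (L w)) (at (0::complex))"
    by simp_all
  have "eval3 F (affine_chart i (a + t *s w)) = poly (poly ?f [:t * w $ 1:]) (t * w $ 2)" for t w
  proof -
    have "vector [t * w $ 1, t * w $ 2] = t *s w" by (simp add: vec_eq_iff forall_2)
    then show ?thesis by (simp add: poly_loc)
  qed
  with lim have jet: "coeff2 ?f 0 0 = 0 \<and> coeff2 ?f 1 0 * w $ 1 + coeff2 ?f 0 1 * w $ 2 = 0 \<and>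
    coeff2 ?f 2 0 * (w $ 1)^2 + coeff2 ?f 1 1 * w $ 1 * w $ 2 + coeff2 ?f 0 2 * (w $ 2)^2
      = c * ade_quadratic T (L w)" for w
    by (intro quadratic_jet) simp
  have "vanishes 2 ?f"
    unfolding vanishes_def
  proof (intro allI impI)
    fix k l :: nat assume "k + l < 2"
    then have "(k, l) \<in> {(0, 0), (1, 0), (0, 1)}" by auto
    then show "coeff2 ?f k l = 0"
      using jet[of "vector [1, 0]"] jet[of "vector [0, 1]"] by auto
  qed
  with jet L show ?thesis by blast
qed

lemma A1_jet:
  assumes "analytically_equivalent (\<lambda>x. eval3 F (affine_chart i x)) a (ade_equation (A 1)) 0"
  shows "vanishes 2 (loc i a F)" "\<not> vanishes 3 (loc i a F)"
proof -
  let ?f = "loc i a F"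
  have jet: "vanishes 2 ?f \<and> (\<exists>c (L :: complex^2 \<Rightarrow> complex^2). c \<noteq> 0 \<and> linear L \<and> (\<forall>c v. L (c *s v) = c *s L v) \<and> bij L \<and>
    (\<forall>w. coeff2 ?f 2 0 * (w $ 1)^2 + coeff2 ?f 1 1 * w $ 1 * w $ 2 +
      coeff2 ?f 0 2 * (w $ 2)^2 = c * ade_quadratic (A 1) (L w)))"
    using assms by (rule ade_jet) simp
  then show "vanishes 2 ?f" ..
  from jet[THEN conjunct2] obtain c and L :: "complex^2 \<Rightarrow> complex^2" where
    "c \<noteq> 0 \<and> linear L \<and> (\<forall>c v. L (c *s v) = c *s L v) \<and> bij L \<and>
    (\<forall>w. coeff2 ?f 2 0 * (w $ 1)^2 + coeff2 ?f 1 1 * w $ 1 * w $ 2 +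
      coeff2 ?f 0 2 * (w $ 2)^2 = c * ade_quadratic (A 1) (L w))"
    by (elim exE)
  then have L: "c \<noteq> 0" "bij L"
    and q: "\<And>w. coeff2 ?f 2 0 * (w $ 1)^2 + coeff2 ?f 1 1 * w $ 1 * w $ 2 +
      coeff2 ?f 0 2 * (w $ 2)^2 = c * ade_quadratic (A 1) (L w)"
    by simp_all
  obtain w where w: "L w = vector [1, 0]" using L(2) by (metis bij_pointE)
  show "\<not> vanishes 3 ?f"
  proof
    assume "vanishes 3 ?f"
    then have "coeff2 ?f 2 0 = 0" "coeff2 ?f 1 1 = 0" "coeff2 ?f 0 2 = 0" by (auto simp: vanishes_def)
    with L(1) q[of w] show False
      by (simp add: w ade_quadratic_def)
  qed
qed

text \<open>The quadratic part is a constant times the square of the first coordinate of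
  \<open>L\<close>, a linear form; evaluation at \<open>(1, 1)\<close> isolates the mixed
  coefficient.\<close>

lemma A2_jet:
  assumes "analytically_equivalent (\<lambda>x. eval3 F (affine_chart i x)) a (ade_equation (A 2)) 0"
  shows "vanishes 2 (loc i a F) \<and> (\<exists>c l1 l2. coeff2 (loc i a F) 2 0 = c * l1^2 \<and>
    coeff2 (loc i a F) 1 1 = 2 * c * l1 * l2 \<and> coeff2 (loc i a F) 0 2 = c * l2^2)"
proof -
  let ?f = "loc i a F"
  have jet: "vanishes 2 ?f \<and> (\<exists>c (L :: complex^2 \<Rightarrow> complex^2). c \<noteq> 0 \<and> linear L \<and> (\<forall>c v. L (c *s v) = c *s L v) \<and> bij L \<and>
    (\<forall>w. coeff2 ?f 2 0 * (w $ 1)^2 + coeff2 ?f 1 1 * w $ 1 * w $ 2 +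
      coeff2 ?f 0 2 * (w $ 2)^2 = c * ade_quadratic (A 2) (L w)))"
    using assms by (rule ade_jet) simp
  from jet[THEN conjunct2] obtain c and L :: "complex^2 \<Rightarrow> complex^2" where
    "c \<noteq> 0 \<and> linear L \<and> (\<forall>c v. L (c *s v) = c *s L v) \<and> bij L \<and>
    (\<forall>w. coeff2 ?f 2 0 * (w $ 1)^2 + coeff2 ?f 1 1 * w $ 1 * w $ 2 +
      coeff2 ?f 0 2 * (w $ 2)^2 = c * ade_quadratic (A 2) (L w))"
    by (elim exE)
  then have L: "linear L"
    and q: "\<And>w. coeff2 ?f 2 0 * (w $ 1)^2 + coeff2 ?f 1 1 * w $ 1 * w $ 2 +
      coeff2 ?f 0 2 * (w $ 2)^2 = c * ade_quadratic (A 2) (L w)"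
    by simp_all
  have q2: "coeff2 ?f 2 0 * (w $ 1)^2 + coeff2 ?f 1 1 * w $ 1 * w $ 2 + coeff2 ?f 0 2 * (w $ 2)^2 =
      c * (L w $ 1)^2" for w
    using q by (simp add: ade_quadratic_def)
  define l1 where "l1 = L (vector [1, 0]) $ 1"
  define l2 where "l2 = L (vector [0, 1]) $ 1"
  have "(vector [1, 1] :: complex^2) = vector [1, 0] + vector [0, 1]"
    by (simp add: vec_eq_iff forall_2)
  then have "L (vector [1, 1]) = L (vector [1, 0] + vector [0, 1])"
    by (rule arg_cong)
  also have "\<dots> = L (vector [1, 0]) + L (vector [0, 1])"
    by (rule linear_add[OF L])
  finally have "L (vector [1, 1]) = L (vector [1, 0]) + L (vector [0, 1])" .
  then have "L (vector [1, 1]) $ 1 = l1 + l2"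
    by (simp only: l1_def l2_def vector_add_component)
  then have "coeff2 ?f 2 0 + coeff2 ?f 1 1 + coeff2 ?f 0 2 = c * (l1 + l2)^2"
    using q2[of "vector [1, 1]"] by simp
  moreover have f: "coeff2 ?f 2 0 = c * l1^2" "coeff2 ?f 0 2 = c * l2^2"
    using q2[of "vector [1, 0]"] q2[of "vector [0, 1]"] by (simp_all add: l1_def l2_def)
  ultimately have "coeff2 ?f 1 1 = 2 * c * l1 * l2"
    by (simp add: power2_eq_square algebra_simps)
  with f jet show ?thesis by blast
qed

text \<open>All terms with the factor \<open>\<pi>\<close> have order at least 2, so the linear part
  of the polar is the derivative of the quadratic part of \<open>f\<close> in the direction
  \<open>(\<alpha>, \<beta>)\<close>.\<close>

lemma polar_jet:
  assumes F: "homogeneous n F" and f: "vanishes 2 (loc i a F)"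
  obtains \<alpha> \<beta> where "vanishes 1 (loc i a (polar v F))"
    "coeff2 (loc i a (polar v F)) 1 0 = 2 * \<alpha> * coeff2 (loc i a F) 2 0 + \<beta> * coeff2 (loc i a F) 1 1"
    "coeff2 (loc i a (polar v F)) 0 1 = \<alpha> * coeff2 (loc i a F) 1 1 + 2 * \<beta> * coeff2 (loc i a F) 0 2"
proof -
  let ?f = "loc i a F"
  obtain \<pi> \<alpha> \<beta> where g: "loc i a (polar v F) = const2 (\<pi> * of_nat n) * ?f + const2 \<alpha> * dY ?f
       + const2 \<beta> * dZ ?f - const2 \<pi> * (Y2 * dY ?f + Z2 * dZ ?f)"
    by (rule loc_euler[OF F])
  have f0: "coeff2 ?f 0 0 = 0" "coeff2 ?f (Suc 0) 0 = 0" "coeff2 ?f 0 (Suc 0) = 0"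
    using f by (auto simp: vanishes_def)
  have c: "coeff2 (loc i a (polar v F)) k l = \<pi> * of_nat n * coeff2 ?f k l + \<alpha> * coeff2 (dY ?f) k l
      + \<beta> * coeff2 (dZ ?f) k l - \<pi> * (coeff2 (Y2 * dY ?f) k l + coeff2 (Z2 * dZ ?f) k l)" for k l
    unfolding g by (simp only: coeff_add coeff_diff coeff2_const2_mult)
  show thesis
    by (rule that[of \<alpha> \<beta>])
      (simp_all add: vanishes_1 c coeff2_simps f0 numeral_2_eq_2 del: One_nat_def
        mult_pCons_left mult_pCons_right, simp_all add: f0)
qed

text \<open>At its own centre the polar expands to \<open>n\<close> times \<open>f\<close> minus the
  Euler derivative of \<open>f\<close>, so the part of degree \<open>k\<close> is multiplied by
  \<open>n - k\<close>. The quadratic parts therefore cancel in the difference.\<close>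

lemma polar_jet_center:
  assumes F: "homogeneous n F" and f: "vanishes 2 (loc i a F)"
  shows "vanishes 3 (const2 (of_nat n - 2) * loc i a F - loc i a (polar (affine_chart i a) F))"
proof -
  let ?f = "loc i a F" and ?v = "affine_chart i a"
  obtain \<pi> \<alpha> \<beta> where g: "loc i a (polar ?v F) = const2 (\<pi> * of_nat n) * ?f + const2 \<alpha> * dY ?f
       + const2 \<beta> * dZ ?f - const2 \<pi> * (Y2 * dY ?f + Z2 * dZ ?f)"
    and 1: "\<pi> = 1" "\<alpha> = 0" "\<beta> = 0"
    using loc_euler[OF F, of i a ?v] by metis
  have c: "coeff2 (const2 (of_nat n - 2) * ?f - loc i a (polar ?v F)) k l =
      (of_nat n - 2) * coeff2 ?f k l - (of_nat n * coeff2 ?f k l - (of_nat k * coeff2 ?f k l + of_nat l * coeff2 ?f k l))"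
    for k l
  proof -
    have "coeff2 (Y2 * dY ?f) k l = of_nat k * coeff2 ?f k l"
      unfolding coeff2_Y2_mult coeff2_deriv by (cases k) simp_all
    moreover have "coeff2 (Z2 * dZ ?f) k l = of_nat l * coeff2 ?f k l"
      unfolding coeff2_Z2_mult coeff2_deriv by (cases l) simp_all
    ultimately show ?thesis
      unfolding g 1 coeff_add coeff_diff coeff2_const2_mult by simp
  qed
  show ?thesis
    unfolding vanishes_def
  proof (intro allI impI)
    fix k l :: nat assume "k + l < 3"
    then consider "k + l < 2" | "k + l = 2" by linarith
    then show "coeff2 (const2 (of_nat n - 2) * ?f - loc i a (polar ?v F)) k l = 0"
    proof cases
      case 1
      then have "coeff2 ?f k l = 0" using f by (auto simp: vanishes_def)
      then show ?thesis unfolding c by simp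
    next
      case 2
      then have "of_nat k + of_nat l = (2 :: complex)" by (metis of_nat_add of_nat_numeral)
      then show ?thesis unfolding c by (simp add: algebra_simps flip: distrib_right)
    qed
  qed
qed

section \<open>The inequality\<close>

text \<open>A single polar curve, that of \<open>P\<close>, is used at all points. Choosing its
  centre on the curve improves the contribution of \<open>P\<close> from 2 to 6, while the bounds at
  the other points hold for every polar.\<close>

lemma class_bound_from_node:
  assumes F: "homogeneous n F" "irreducible F" "n > 2"
    and fin: "finite S" and S: "\<And>p. p \<in> S \<Longrightarrow> has_ade_type F p (A 1) \<or> has_ade_type F p (A 2)"
    and P: "P \<in> S" "has_ade_type F P (A 1)"
  shows "(\<Sum>p\<in>S. if p = P then 6 else if has_ade_type F p (A 1) then 2 else 3) \<le> n * (n - 1)"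
proof -
  have "\<exists>x k. p = proj_pt (affine_chart (fst x) (snd x)) \<and> k \<in> {1, 2} \<and>
      (k = 1 \<longleftrightarrow> has_ade_type F p (A 1)) \<and>
      analytically_equivalent (\<lambda>y. eval3 F (affine_chart (fst x) y)) (snd x) (ade_equation (A k)) 0"
    if p: "p \<in> S" for p
  proof -
    obtain k where k: "k \<in> {1, 2}" "k = 1 \<longleftrightarrow> has_ade_type F p (A 1)" "has_ade_type F p (A k)"
      using S[OF p] by (cases "has_ade_type F p (A 1)") auto
    from k(3) obtain i a where "p = proj_pt (affine_chart i a)"
      "analytically_equivalent (\<lambda>y. eval3 F (affine_chart i y)) a (ade_equation (A k)) 0"
      unfolding has_ade_type_def by blast
    with k show ?thesis by (intro exI[of _ "(i, a)"] exI[of _ k]) simp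
  qed
  then have "\<forall>p\<in>S. \<exists>x k. p = proj_pt (affine_chart (fst x) (snd x)) \<and> k \<in> {1, 2} \<and>
      (k = 1 \<longleftrightarrow> has_ade_type F p (A 1)) \<and>
      analytically_equivalent (\<lambda>y. eval3 F (affine_chart (fst x) y)) (snd x) (ade_equation (A k)) 0"
    by (intro ballI)
  then obtain \<rho> \<kappa> where rk: "\<forall>p\<in>S. p = proj_pt (affine_chart (fst (\<rho> p)) (snd (\<rho> p))) \<and> \<kappa> p \<in> {1, 2} \<and>
      (\<kappa> p = 1 \<longleftrightarrow> has_ade_type F p (A 1)) \<and>
      analytically_equivalent (\<lambda>y. eval3 F (affine_chart (fst (\<rho> p)) y)) (snd (\<rho> p)) (ade_equation (A (\<kappa> p))) 0"
    unfolding bchoice_iff by (elim exE)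
  define Q where "Q = (\<lambda>(i, a). proj_pt (affine_chart i a))"
  have Q\<rho>: "Q (\<rho> p) = p" if "p \<in> S" for p
    using rk that by (simp add: Q_def case_prod_unfold)
  define r where "r = (\<lambda>p. if p = P then 6 else if has_ade_type F p (A 1) then 2 else (3::nat))"
  let ?G = "polar (affine_chart (fst (\<rho> P)) (snd (\<rho> P))) F"
  let ?f = "\<lambda>p. loc (fst (\<rho> p)) (snd (\<rho> p)) F" and ?g = "\<lambda>p. loc (fst (\<rho> p)) (snd (\<rho> p)) ?G"
  have eqv: "analytically_equivalent (\<lambda>y. eval3 F (affine_chart (fst (\<rho> p)) y)) (snd (\<rho> p)) (ade_equation (A (\<kappa> p))) 0"
    "\<kappa> p = 1 \<or> \<kappa> p = 2" "\<kappa> p = 1 \<longleftrightarrow> has_ade_type F p (A 1)" if "p \<in> S" for p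
    using bspec[OF rk that] by auto
  have f2: "vanishes 2 (?f p)" if "p \<in> S" for p
    using eqv(2)[OF that] A1_jet(1) A2_jet eqv(1)[OF that] by (elim disjE) simp_all
  have node: "vanishes 2 (?f P)" "\<not> vanishes 3 (?f P)"
    using A1_jet[OF eqv(1)[OF P(1), unfolded eqv(3)[OF P(1), THEN iffD2, OF P(2)]]] by simp_all
  have h: "vanishes 3 (const2 (of_nat n - 2) * ?f P - ?g P)"
    by (rule polar_jet_center[OF F(1) node(1)])
  \<comment> \<open>The quadratic part of the polar at \<open>P\<close> is \<open>n - 2\<close>
    times that of \<open>F\<close>, which is nonzero at a node.\<close>
  have "?G \<noteq> 0"
  proof
    assume "?G = 0"
    with h have "vanishes 3 (const2 (of_nat n - 2) * ?f P)" by simp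
    moreover have "of_nat n - 2 \<noteq> (0::complex)"
      using F(3) by (metis eq_iff_diff_eq_0 less_irrefl of_nat_eq_iff of_nat_numeral)
    ultimately show False
      using node(2) by (auto simp: vanishes_def)
  qed
  then have ndvd: "\<not> F dvd ?G"
    using F(3) by (intro homogeneous_not_dvd[OF F(1) homogeneous_polar[OF F(1)]]) auto
  have "(\<Sum>x\<in>\<rho> ` S. r (Q x)) \<le> n * (n - 1)"
  proof (rule bezout_inequality[OF F(1) _ homogeneous_polar[OF F(1)] ndvd])
    show "prime_elem F" using F(2) by (simp add: prime_elem_iff_irreducible)
    show "finite (\<rho> ` S)" using fin by simp
    show "inj_on (\<lambda>(i, a). proj_pt (affine_chart i a)) (\<rho> ` S)"
      unfolding Q_def[symmetric] by (rule inj_on_inverseI[of _ \<rho>]) (auto simp: Q\<rho>)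
    fix i a assume "(i, a) \<in> \<rho> ` S"
    then obtain p where p: "p \<in> S" and ia: "\<rho> p = (i, a)" by force
    have r: "r (Q (i, a)) = r p" using Q\<rho>[OF p] ia by simp
    have f: "vanishes 2 (loc i a F)" using f2[OF p] ia by simp
    obtain \<alpha> \<beta> where g: "vanishes 1 (loc i a ?G)"
      "coeff2 (loc i a ?G) 1 0 = 2 * \<alpha> * coeff2 (loc i a F) 2 0 + \<beta> * coeff2 (loc i a F) 1 1"
      "coeff2 (loc i a ?G) 0 1 = \<alpha> * coeff2 (loc i a F) 1 1 + 2 * \<beta> * coeff2 (loc i a F) 0 2"
      by (rule polar_jet[OF F(1) f])
    consider "p = P" | "p \<noteq> P" "has_ade_type F p (A 1)" | "p \<noteq> P" "\<not> has_ade_type F p (A 1)" by blast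
    then show "local_codim_ge (loc i a F) (loc i a ?G) (r (Q (i, a)))"
    proof cases
      case 1
      then show ?thesis
        using local_codim_double_projection[OF f] h ia r by (simp add: r_def)
    next
      case 2
      then show ?thesis
        using local_codim_singular[OF f g(1)] r by (simp add: r_def)
    next
      case 3
      then have "\<kappa> p = 2" using eqv(2,3)[OF p] by simp
      then have "analytically_equivalent (\<lambda>y. eval3 F (affine_chart i y)) a (ade_equation (A 2)) 0"
        using eqv(1)[OF p] ia by simp
      then obtain c l1 l2 where q: "coeff2 (loc i a F) 2 0 = c * l1^2"
        "coeff2 (loc i a F) 1 1 = 2 * c * l1 * l2" "coeff2 (loc i a F) 0 2 = c * l2^2"
        using A2_jet by blast
      \<comment> \<open>The derivative of \<open>c * l^2\<close> in the direction
        \<open>(\<alpha>, \<beta>)\<close> is \<open>2 * c * l\<close> times the value of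
        \<open>l\<close> at that direction; this value is the \<open>s\<close> of the cusp
        bound.\<close>
      have "local_codim_ge (loc i a F) (loc i a ?G) 3"
        by (rule local_codim_cusp[OF f g(1) q, of "\<alpha> * l1 + \<beta> * l2"])
          (unfold g(2,3) q, simp_all add: algebra_simps power2_eq_square)
      with 3 show ?thesis using r by (simp add: r_def)
    qed
  qed
  also have "(\<Sum>x\<in>\<rho> ` S. r (Q x)) = (\<Sum>p\<in>S. r p)"
    by (subst sum.reindex) (auto simp: Q\<rho> intro!: inj_on_inverseI[of S Q])
  finally show ?thesis by (simp add: r_def)
qed

theorem proposition4p2:
  fixes n n\<^sub>1 n\<^sub>2 :: nat and C :: poly3
  assumes "MK_curve n C" and "irreducible C" and "even n" and "n \<ge> 8"
    and "n\<^sub>1 = card {p \<in> Sing C. has_ade_type C p (A 1)}"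
    and "n\<^sub>2 = card {p \<in> Sing C. has_ade_type C p (A 2)}"
    and "\<forall>p\<in>Sing C. has_ade_type C p (A 1) \<or> has_ade_type C p (A 2)"
  shows "int n\<^sub>2 - int n\<^sub>1 \<ge> 20 - int n"
proof -
  let ?S1 = "{p \<in> Sing C. has_ade_type C p (A 1)}" and ?S2 = "{p \<in> Sing C. has_ade_type C p (A 2)}"
  have hom: "homogeneous n C" and MK: "MK_number_curve C = real n / 2 * (5 * real n - 6)"
    using assms(1) by (auto simp: MK_curve_def reduced_plane_curve_def)
  note unique = has_ade_type_unique[OF hom]
  \<comment> \<open>A sum over an infinite set is 0 by convention, whereas the prescribed value of
    m(C) is positive.\<close>
  have fin: "finite (Sing C)"
  proof (rule ccontr)
    assume "infinite (Sing C)"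
    then have "MK_number_curve C = 0" by (simp add: MK_number_curve_def)
    moreover have "real n / 2 * (5 * real n - 6) > 0"
      using assms(4) by (intro mult_pos_pos) auto
    ultimately show False using MK by linarith
  qed
  have Sing: "Sing C = ?S1 \<union> ?S2" using assms(7) by blast
  have disj: "?S1 \<inter> ?S2 = {}"
    using unique[of 1 _ "A 2"] by auto
  have m: "MK_number_at C p = MK_number (A k)" if "k \<in> {1, 2}" "has_ade_type C p (A k)" for p k
    unfolding MK_number_at_def using that unique[OF that] by (metis the_equality)
  have "MK_number_curve C = (\<Sum>p\<in>?S1. MK_number_at C p) + (\<Sum>p\<in>?S2. MK_number_at C p)"
    unfolding MK_number_curve_def using fin disj by (subst (1) Sing) (intro sum.union_disjoint, auto)
  \<comment> \<open>The values are 6 - 3/2 = 9/2 for A1 and 9 - 1 = 8 for A2.\<close>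
  also have "(\<Sum>p\<in>?S1. MK_number_at C p) = (\<Sum>p\<in>?S1. 9 / 2)"
    using m[of 1] by (intro sum.cong) auto
  also have "(\<Sum>p\<in>?S2. MK_number_at C p) = (\<Sum>p\<in>?S2. 8)"
    using m[of 2] by (intro sum.cong) auto
  finally have "9 / 2 * real n\<^sub>1 + 8 * real n\<^sub>2 = real n / 2 * (5 * real n - 6)"
    unfolding MK assms(5,6) by simp
  then have "real_of_int (9 * int n\<^sub>1 + 16 * int n\<^sub>2) = real_of_int (int n * (5 * int n - 6))"
    by (simp add: field_simps)
  then have miyaoka: "9 * int n\<^sub>1 + 16 * int n\<^sub>2 = int n * (5 * int n - 6)"
    by (simp only: of_int_eq_iff)
  show ?thesis
  proof (cases "n\<^sub>1 = 0")
    case True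
    \<comment> \<open>The factor 34 is \<open>5 * 8 - 6\<close>. Thus \<open>16 * n\<^sub>2\<close>
      is at least \<open>34 * n\<close>, so \<open>n\<^sub>2\<close> exceeds 16, while
      \<open>20 - n\<close> is at most 12.\<close>
    have "int n * (5 * int n - 6) \<ge> int n * 34"
      using assms(4) by (intro mult_left_mono) auto
    with True miyaoka assms(4) show ?thesis by linarith
  next
    case False
    then obtain P where P: "P \<in> Sing C" "has_ade_type C P (A 1)"
      unfolding assms(5) by (metis (mono_tags, lifting) card.empty empty_Collect_eq)
    let ?r = "\<lambda>p. if p = P then 6 else if has_ade_type C p (A 1) then 2 else (3::nat)"
    have "(\<Sum>p\<in>Sing C. ?r p) = (\<Sum>p\<in>?S1. ?r p) + (\<Sum>p\<in>?S2. ?r p)"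
      using fin disj by (subst (1) Sing) (intro sum.union_disjoint, auto)
    also have "(\<Sum>p\<in>?S1. ?r p) = 6 + (\<Sum>p\<in>?S1 - {P}. 2)"
      using fin P by (subst sum.remove[of _ P]) auto
    also have "(\<Sum>p\<in>?S2. ?r p) = (\<Sum>p\<in>?S2. 3)"
      using disj P by (intro sum.cong) auto
    finally have "6 + 2 * (n\<^sub>1 - 1) + 3 * n\<^sub>2 \<le> n * (n - 1)"
      using class_bound_from_node[OF hom assms(2) _ fin _ P] assms(4,5,6,7) P fin
      by (simp add: card_Diff_singleton)
    then have "int (6 + 2 * (n\<^sub>1 - 1) + 3 * n\<^sub>2) \<le> int (n * (n - 1))"
      by (simp only: of_nat_le_iff)
    then have "2 * int n\<^sub>1 + 3 * int n\<^sub>2 + 4 \<le> int n * (int n - 1)"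
      using False assms(4) by (simp add: of_nat_diff)
    \<comment> \<open>Five times the inequality, with \<open>5 * n^2\<close> eliminated by
      \<open>miyaoka\<close>, is the claim; the surplus 4 from \<open>P\<close> becomes the constant
      20.\<close>
    with miyaoka show ?thesis by (simp add: algebra_simps)
  qed
qed

end
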